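(* Let $R$ be a left QI-ring and let $\tau\in R\text{-tors}$ be a perfect torsion theory. Then the ring of quotients ${}_\tau R$ is a left QI-ring.
   Context: Rings are associative with unit; modules are unitary left modules. A module $M$ is quasi-injective if every homomorphism $f:N\to M$ with $N\le M$ extends to an endomorphism of $M$. A ring is a left QI-ring if every quasi-injective left module over it is injective. Torsion theories. A torsion theory in $R$-Mod is a pair $\tau=(\mathfrak T,\mathfrak F)$ of nonempty classes of modules such that $\mathrm{Hom}_R(T,F)=0$ for all $T\in\mathfrak T$, $F\in\mathfrak F$; any $M$ with $\mathrm{Hom}_R(M,F)=0$ for all $F\in\mathfrak F$ lies in $\mathfrak T$; and any $N$ with $\mathrm{Hom}_R(T,N)=0$ for all $T\in\mathfrak T$ lies in $\mathfrak F$. Modules in $\mathfrak T$ are called $\tau$-torsion, those in $\mathfrak F$ $\tau$-torsion free. It is hereditary if $\mathfrak T$ is closed under submodules. $R\text{-tors}$ denotes the set of hereditary torsion theories in $R$-Mod. Localization. For $\tau\in R\text{-tors}$ let $\mathcal F_\tau$ be its Gabriel topology, the set of left ideals $I$ with $R/I$ $\tau$-torsion. A module $N$ is $\mathcal F_\tau$-injective if every homomorphism $I\to N$ with $I\in\mathcal F_\tau$ extends to $R\to N$; it is $\tau$-closed if it is $\tau$-torsion free and $\mathcal F_\tau$-injective. For every module $M$ there is an essentially unique $\tau$-closed module ${}_\tau M$ with a homomorphism $\psi_M:M\to{}_\tau M$ whose kernel and cokernel are $\tau$-torsion. ${}_\tau R$ is a ring (the ring of quotients) and $\psi_R:R\to{}_\tau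 R$ is a ring homomorphism. Perfect. If $\varphi:R\to S$ is an epimorphism in the category of rings which makes $S$ into a flat right $R$-module, then $S$ is called a left perfect localization of $R$. A hereditary torsion theory $\tau\in R\text{-tors}$ is perfect if the ring of quotients ${}_\tau R$ (with $\psi_R$) is a left perfect localization of $R$. *)

theory Defs
  imports "HOL-Algebra.Module" "HOL-Algebra.AbelCoset" "HOL-Algebra.Free_Abelian_Groups"
    "HOL-Library.Equipollence"
begin

text \<open>
  Size convention. "All modules" (or "all rings") is read as: all modules (rings) whose carrier is a
  set of elements of a type \<open>'u\<close>, which plays the role of the universe. A notion that depends on the
  universe takes it as an argument \<open>TYPE('u)\<close>, unless the type of a module or of a torsion
  theory among its arguments already fixes \<open>'u\<close>: an \<open>('a, 'u)\<close> module is injective if it is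
  so with respect to all monomorphisms between \<open>('a, 'u)\<close> modules.
  For a ring \<open>R\<close>, a type \<open>'u\<close> is large enough as soon as it contains a copy of the power set of
  \<open>carrier R \<times> UNIV\<close> (with \<open>UNIV\<close> the naturals): then it contains a copy of \<open>R\<close>, of every cyclic
  module and of the injective hull of every cyclic module.
\<close>

section \<open>Modules over a ring that need not be commutative\<close>

text \<open>
  The library record \<open>('a, 'm) module\<close> is used for left and right modules; its fields \<open>mult\<close> and
  \<open>one\<close> are never inspected. The library locale \<open>module\<close> requires a commutative ring, whereas the
  library locale \<open>submodule\<close> does not and is used as it is.
\<close>

locale left_module = R?: ring R + M?: abelian_group M
  for R :: "('a, 'r) ring_scheme" (structure) and M :: "('a, 'm) module" (structure) +
  assumes smult_closed: "\<lbrakk>a \<in> carrier R; x \<in> carrier M\<rbrakk> \<Longrightarrow> a \<odot>\<^bsub>M\<^esub> x \<in> carrier M"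
    and smult_l_distr: "\<lbrakk>a \<in> carrier R; b \<in> carrier R; x \<in> carrier M\<rbrakk>
      \<Longrightarrow> (a \<oplus>\<^bsub>R\<^esub> b) \<odot>\<^bsub>M\<^esub> x = a \<odot>\<^bsub>M\<^esub> x \<oplus>\<^bsub>M\<^esub> b \<odot>\<^bsub>M\<^esub> x"
    and smult_r_distr: "\<lbrakk>a \<in> carrier R; x \<in> carrier M; y \<in> carrier M\<rbrakk>
      \<Longrightarrow> a \<odot>\<^bsub>M\<^esub> (x \<oplus>\<^bsub>M\<^esub> y) = a \<odot>\<^bsub>M\<^esub> x \<oplus>\<^bsub>M\<^esub> a \<odot>\<^bsub>M\<^esub> y"
    and smult_assoc: "\<lbrakk>a \<in> carrier R; b \<in> carrier R; x \<in> carrier M\<rbrakk>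
      \<Longrightarrow> (a \<otimes>\<^bsub>R\<^esub> b) \<odot>\<^bsub>M\<^esub> x = a \<odot>\<^bsub>M\<^esub> (b \<odot>\<^bsub>M\<^esub> x)"
    and smult_one: "x \<in> carrier M \<Longrightarrow> \<one>\<^bsub>R\<^esub> \<odot>\<^bsub>M\<^esub> x = x"

text \<open>For a right module, \<open>a \<odot>\<^bsub>P\<^esub> p\<close> denotes the product of \<open>p\<close> with \<open>a\<close> on its right.\<close>

locale right_module = R?: ring R + P?: abelian_group P
  for R :: "('a, 'r) ring_scheme" (structure) and P :: "('a, 'p) module" (structure) +
  assumes smult_closed: "\<lbrakk>a \<in> carrier R; x \<in> carrier P\<rbrakk> \<Longrightarrow> a \<odot>\<^bsub>P\<^esub> x \<in> carrier P"
    and smult_l_distr: "\<lbrakk>a \<in> carrier R; b \<in> carrier R; x \<in> carrier P\<rbrakk>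
      \<Longrightarrow> (a \<oplus>\<^bsub>R\<^esub> b) \<odot>\<^bsub>P\<^esub> x = a \<odot>\<^bsub>P\<^esub> x \<oplus>\<^bsub>P\<^esub> b \<odot>\<^bsub>P\<^esub> x"
    and smult_r_distr: "\<lbrakk>a \<in> carrier R; x \<in> carrier P; y \<in> carrier P\<rbrakk>
      \<Longrightarrow> a \<odot>\<^bsub>P\<^esub> (x \<oplus>\<^bsub>P\<^esub> y) = a \<odot>\<^bsub>P\<^esub> x \<oplus>\<^bsub>P\<^esub> a \<odot>\<^bsub>P\<^esub> y"
    and smult_assoc: "\<lbrakk>a \<in> carrier R; b \<in> carrier R; x \<in> carrier P\<rbrakk>
      \<Longrightarrow> (a \<otimes>\<^bsub>R\<^esub> b) \<odot>\<^bsub>P\<^esub> x = b \<odot>\<^bsub>P\<^esub> (a \<odot>\<^bsub>P\<^esub> x)"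
    and smult_one: "x \<in> carrier P \<Longrightarrow> \<one>\<^bsub>R\<^esub> \<odot>\<^bsub>P\<^esub> x = x"

definition lmod_hom ::
  "('a, 'r) ring_scheme \<Rightarrow> ('a, 'm) module \<Rightarrow> ('a, 'n) module \<Rightarrow> ('m \<Rightarrow> 'n) set" where
  "lmod_hom R M N = {f \<in> carrier M \<rightarrow> carrier N.
     (\<forall>x\<in>carrier M. \<forall>y\<in>carrier M. f (x \<oplus>\<^bsub>M\<^esub> y) = f x \<oplus>\<^bsub>N\<^esub> f y) \<and>
     (\<forall>a\<in>carrier R. \<forall>x\<in>carrier M. f (a \<odot>\<^bsub>M\<^esub> x) = a \<odot>\<^bsub>N\<^esub> f x)}"

definition lmod_isomorphic :: "('a, 'r) ring_scheme \<Rightarrow> ('a, 'm) module \<Rightarrow> ('a, 'n) module \<Rightarrow> bool"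
  where "lmod_isomorphic R M N \<longleftrightarrow> (\<exists>f\<in>lmod_hom R M N. bij_betw f (carrier M) (carrier N))"

definition hom_vanishes :: "('a, 'r) ring_scheme \<Rightarrow> ('a, 'm) module \<Rightarrow> ('a, 'n) module \<Rightarrow> bool" where
  "hom_vanishes R M N \<longleftrightarrow> (\<forall>f\<in>lmod_hom R M N. \<forall>x\<in>carrier M. f x = \<zero>\<^bsub>N\<^esub>)"

definition quot_lmod :: "('a, 'm) module \<Rightarrow> 'm set \<Rightarrow> ('a, 'm set) module" where
  "quot_lmod M N = \<lparr>carrier = a_rcosets\<^bsub>M\<^esub> N, monoid.mult = undefined, monoid.one = undefined,
     ring.zero = N, add = set_add M, smult = (\<lambda>a C. \<Union>x\<in>C. N +>\<^bsub>M\<^esub> (a \<odot>\<^bsub>M\<^esub> x))\<rparr>"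

text \<open>\<open>left_via S \<phi>\<close> and \<open>right_via S \<phi>\<close>: the ring \<open>S\<close> as a left, respectively right,
  \<open>R\<close>-module by restriction of scalars along \<open>\<phi>\<close>.\<close>

definition left_via :: "('s, 'z) ring_scheme \<Rightarrow> ('a \<Rightarrow> 's) \<Rightarrow> ('a, 's) module" where
  "left_via S \<phi> = \<lparr>carrier = carrier S, monoid.mult = monoid.mult S, monoid.one = monoid.one S,
     ring.zero = ring.zero S, add = add S,
     smult = (\<lambda>a s. \<phi> a \<otimes>\<^bsub>S\<^esub> s)\<rparr>"

definition right_via :: "('s, 'z) ring_scheme \<Rightarrow> ('a \<Rightarrow> 's) \<Rightarrow> ('a, 's) module" where
  "right_via S \<phi> = \<lparr>carrier = carrier S, monoid.mult = monoid.mult S, monoid.one = monoid.one S,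
     ring.zero = ring.zero S, add = add S,
     smult = (\<lambda>a s. s \<otimes>\<^bsub>S\<^esub> \<phi> a)\<rparr>"

abbreviation regular_lmod :: "('a, 'r) ring_scheme \<Rightarrow> ('a, 'a) module" where
  "regular_lmod R \<equiv> left_via R (\<lambda>a. a)"

section \<open>QI-rings\<close>

definition quasi_injective :: "('a, 'r) ring_scheme \<Rightarrow> ('a, 'm) module \<Rightarrow> bool" where
  "quasi_injective R M \<longleftrightarrow> left_module R M \<and>
     (\<forall>N f. submodule N R M \<and> f \<in> lmod_hom R (M\<lparr>carrier := N\<rparr>) M
        \<longrightarrow> (\<exists>g\<in>lmod_hom R M M. \<forall>x\<in>N. g x = f x))"

definition injective_lmod :: "('a, 'r) ring_scheme \<Rightarrow> ('a, 'u) module \<Rightarrow> bool" where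
  "injective_lmod R M \<longleftrightarrow> left_module R M \<and>
     (\<forall>(A :: ('a, 'u) module) (B :: ('a, 'u) module) i f.
        left_module R A \<and> left_module R B \<and>
        i \<in> lmod_hom R A B \<and> inj_on i (carrier A) \<and> f \<in> lmod_hom R A M
        \<longrightarrow> (\<exists>g\<in>lmod_hom R B M. \<forall>x\<in>carrier A. g (i x) = f x))"

definition left_QI_ring :: "'u itself \<Rightarrow> ('a, 'r) ring_scheme \<Rightarrow> bool" where
  "left_QI_ring (_ :: 'u itself) R \<longleftrightarrow> ring R \<and>
     (\<forall>M :: ('a, 'u) module. quasi_injective R M \<longrightarrow> injective_lmod R M)"

section \<open>Torsion theories and localization\<close>

type_synonym ('a, 'u) class_pair = "('a, 'u) module set \<times> ('a, 'u) module set"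

definition torsion_theory :: "('a, 'r) ring_scheme \<Rightarrow> ('a, 'u) class_pair \<Rightarrow> bool" where
  "torsion_theory R \<tau> \<longleftrightarrow>
     fst \<tau> \<noteq> {} \<and> snd \<tau> \<noteq> {} \<and>
     (\<forall>T\<in>fst \<tau>. left_module R T) \<and> (\<forall>F\<in>snd \<tau>. left_module R F) \<and>
     (\<forall>T\<in>fst \<tau>. \<forall>F\<in>snd \<tau>. hom_vanishes R T F) \<and>
     (\<forall>M. left_module R M \<and> (\<forall>F\<in>snd \<tau>. hom_vanishes R M F) \<longrightarrow> M \<in> fst \<tau>) \<and>
     (\<forall>N. left_module R N \<and> (\<forall>T\<in>fst \<tau>. hom_vanishes R T N) \<longrightarrow> N \<in> snd \<tau>)"

definition R_tors :: "('a, 'r) ring_scheme \<Rightarrow> ('a, 'u) class_pair set" where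
  "R_tors R = {\<tau>. torsion_theory R \<tau> \<and>
     (\<forall>M\<in>fst \<tau>. \<forall>N. submodule N R M \<longrightarrow> M\<lparr>carrier := N\<rparr> \<in> fst \<tau>)}"

text \<open>Both classes of a torsion theory are closed under isomorphism. The modules below may have a
  carrier in a type other than \<open>'u\<close> (ideals of \<open>R\<close>, or quotients, whose elements are cosets), so
  that membership is meant up to isomorphism.\<close>

definition is_torsion :: "('a, 'r) ring_scheme \<Rightarrow> ('a, 'u) class_pair \<Rightarrow> ('a, 'm) module \<Rightarrow> bool" where
  "is_torsion R \<tau> M \<longleftrightarrow> left_module R M \<and> (\<exists>T\<in>fst \<tau>. lmod_isomorphic R M T)"

definition is_torsion_free :: "('a, 'r) ring_scheme \<Rightarrow> ('a, 'u) class_pair \<Rightarrow> ('a, 'm) module \<Rightarrow> bool"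
  where "is_torsion_free R \<tau> M \<longleftrightarrow> left_module R M \<and> (\<exists>F\<in>snd \<tau>. lmod_isomorphic R M F)"

definition gabriel_topology :: "('a, 'r) ring_scheme \<Rightarrow> ('a, 'u) class_pair \<Rightarrow> 'a set set" where
  "gabriel_topology R \<tau> =
     {I. submodule I R (regular_lmod R) \<and> is_torsion R \<tau> (quot_lmod (regular_lmod R) I)}"

definition gabriel_injective :: "('a, 'r) ring_scheme \<Rightarrow> ('a, 'u) class_pair \<Rightarrow> ('a, 'm) module \<Rightarrow> bool"
  where "gabriel_injective R \<tau> N \<longleftrightarrow> left_module R N \<and>
     (\<forall>I\<in>gabriel_topology R \<tau>. \<forall>f\<in>lmod_hom R ((regular_lmod R)\<lparr>carrier := I\<rparr>) N.
        \<exists>g\<in>lmod_hom R (regular_lmod R) N. \<forall>x\<in>I. g x = f x)"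

definition closed_lmod :: "('a, 'r) ring_scheme \<Rightarrow> ('a, 'u) class_pair \<Rightarrow> ('a, 'm) module \<Rightarrow> bool" where
  "closed_lmod R \<tau> N \<longleftrightarrow> is_torsion_free R \<tau> N \<and> gabriel_injective R \<tau> N"

definition localization_of ::
  "('a, 'r) ring_scheme \<Rightarrow> ('a, 'u) class_pair \<Rightarrow> ('a, 'm) module \<Rightarrow> ('a, 'n) module \<Rightarrow> ('m \<Rightarrow> 'n) \<Rightarrow> bool"
  where "localization_of R \<tau> M N \<psi> \<longleftrightarrow>
     left_module R M \<and> closed_lmod R \<tau> N \<and> \<psi> \<in> lmod_hom R M N \<and>
     is_torsion R \<tau> (M\<lparr>carrier := a_kernel M N \<psi>\<rparr>) \<and>
     is_torsion R \<tau> (quot_lmod N (\<psi> ` carrier M))"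

text \<open>The ring of quotients, with its canonical map, is only determined up to isomorphism; the
  predicate says that \<open>(S, \<psi>)\<close> is one. Its module structure determines its multiplication: right
  multiplication by \<open>s\<close> is the only \<open>R\<close>-endomorphism of \<open>S\<close> that maps \<open>1\<close> to \<open>s\<close>.\<close>

definition ring_of_quotients ::
  "('a, 'r) ring_scheme \<Rightarrow> ('a, 'u) class_pair \<Rightarrow> ('s, 'z) ring_scheme \<Rightarrow> ('a \<Rightarrow> 's) \<Rightarrow> bool" where
  "ring_of_quotients R \<tau> S \<psi> \<longleftrightarrow>
     ring S \<and> \<psi> \<in> ring_hom R S \<and> localization_of R \<tau> (regular_lmod R) (left_via S \<psi>) \<psi>"

section \<open>Perfect torsion theories\<close>

text \<open>The tensor product of a right and a left module: the free abelian group on the pairs modulo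
  the usual relations. In \<open>tensor_map\<close>, the union runs over one and the same coset.\<close>

definition tensor_relations ::
  "('a, 'r) ring_scheme \<Rightarrow> ('a, 'p) module \<Rightarrow> ('a, 'm) module \<Rightarrow> ('p \<times> 'm \<Rightarrow>\<^sub>0 int) set" where
  "tensor_relations R P M = generate (free_Abelian_group (carrier P \<times> carrier M))
     ({frag_of (p \<oplus>\<^bsub>P\<^esub> q, x) - frag_of (p, x) - frag_of (q, x) | p q x.
         p \<in> carrier P \<and> q \<in> carrier P \<and> x \<in> carrier M} \<union>
      {frag_of (p, x \<oplus>\<^bsub>M\<^esub> y) - frag_of (p, x) - frag_of (p, y) | p x y.
         p \<in> carrier P \<and> x \<in> carrier M \<and> y \<in> carrier M} \<union>
      {frag_of (a \<odot>\<^bsub>P\<^esub> p, x) - frag_of (p, a \<odot>\<^bsub>M\<^esub> x) | a p x.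
         a \<in> carrier R \<and> p \<in> carrier P \<and> x \<in> carrier M})"

definition tensor ::
  "('a, 'r) ring_scheme \<Rightarrow> ('a, 'p) module \<Rightarrow> ('a, 'm) module \<Rightarrow> ('p \<times> 'm \<Rightarrow>\<^sub>0 int) set monoid" where
  "tensor R P M = free_Abelian_group (carrier P \<times> carrier M) Mod tensor_relations R P M"

definition tensor_map ::
  "('a, 'r) ring_scheme \<Rightarrow> ('a, 'p) module \<Rightarrow> ('a, 'n) module \<Rightarrow> ('m \<Rightarrow> 'n)
     \<Rightarrow> ('p \<times> 'm \<Rightarrow>\<^sub>0 int) set \<Rightarrow> ('p \<times> 'n \<Rightarrow>\<^sub>0 int) set" where
  "tensor_map R P N f C = (\<Union>c\<in>C. tensor_relations R P N
     #>\<^bsub>free_Abelian_group (carrier P \<times> carrier N)\<^esub> frag_extend (\<lambda>(p, x). frag_of (p, f x)) c)"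

definition flat_right_module :: "'u itself \<Rightarrow> ('a, 'r) ring_scheme \<Rightarrow> ('a, 'p) module \<Rightarrow> bool" where
  "flat_right_module (_ :: 'u itself) R P \<longleftrightarrow> right_module R P \<and>
     (\<forall>(M :: ('a, 'u) module) (N :: ('a, 'u) module) f.
        left_module R M \<and> left_module R N \<and> f \<in> lmod_hom R M N \<and> inj_on f (carrier M)
        \<longrightarrow> inj_on (tensor_map R P N f) (carrier (tensor R P M)))"

definition ring_epimorphism ::
  "'u itself \<Rightarrow> ('a, 'r) ring_scheme \<Rightarrow> ('s, 'z) ring_scheme \<Rightarrow> ('a \<Rightarrow> 's) \<Rightarrow> bool" where
  "ring_epimorphism (_ :: 'u itself) R S \<phi> \<longleftrightarrow> ring R \<and> ring S \<and> \<phi> \<in> ring_hom R S \<and>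
     (\<forall>(T :: 'u ring) g h. ring T \<and> g \<in> ring_hom S T \<and> h \<in> ring_hom S T \<and>
        (\<forall>x\<in>carrier R. g (\<phi> x) = h (\<phi> x)) \<longrightarrow> (\<forall>s\<in>carrier S. g s = h s))"

definition left_perfect_localization ::
  "'u itself \<Rightarrow> ('a, 'r) ring_scheme \<Rightarrow> ('s, 'z) ring_scheme \<Rightarrow> ('a \<Rightarrow> 's) \<Rightarrow> bool" where
  "left_perfect_localization U R S \<phi> \<longleftrightarrow>
     ring_epimorphism U R S \<phi> \<and> flat_right_module U R (right_via S \<phi>)"

definition perfect_torsion_theory :: "('a, 'r) ring_scheme \<Rightarrow> ('a, 'u) class_pair \<Rightarrow> bool" where
  "perfect_torsion_theory R \<tau> \<longleftrightarrow> \<tau> \<in> R_tors R \<and>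
     (\<exists>(S :: 'u ring) \<psi>. ring_of_quotients R \<tau> S \<psi>) \<and>
     (\<forall>(S :: 'u ring) \<psi>. ring_of_quotients R \<tau> S \<psi> \<longrightarrow> left_perfect_localization TYPE('u) R S \<psi>)"

end

theory Submission
  imports Defs "HOL-Algebra.Weak_Morphisms"
begin

text \<open>
  Only the fact that \<open>\<psi>: R \<rightarrow> S\<close> is a flat ring epimorphism matters. Being an epimorphism means
  \<open>s \<otimes> 1 = 1 \<otimes> s\<close> in \<open>S \<otimes>\<^sub>R S\<close> (compare the two homomorphisms \<open>s \<mapsto> (s, 0)\<close> and
  \<open>s \<mapsto> (s, s \<otimes> 1 - 1 \<otimes> s)\<close> into the trivial extension), hence \<open>s \<otimes> x = 1 \<otimes> s x\<close> in \<open>S \<otimes>\<^sub>R M\<close>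
  for every \<open>S\<close>-module \<open>M\<close>: the multiplication \<open>S \<otimes>\<^sub>R M \<rightarrow> M\<close> is injective and \<open>R\<close>-linear maps
  between \<open>S\<close>-modules are \<open>S\<close>-linear.

  Let \<open>M\<close> be quasi-injective over \<open>S\<close>, and \<open>f: N \<rightarrow> M\<close> be \<open>R\<close>-linear on an \<open>R\<close>-submodule \<open>N\<close>. If
  \<open>\<Sum> s\<^sub>i n\<^sub>i = 0\<close> in \<open>M\<close>, then \<open>\<Sum> s\<^sub>i \<otimes> n\<^sub>i\<close> vanishes in \<open>S \<otimes>\<^sub>R M\<close>, by flatness already in
  \<open>S \<otimes>\<^sub>R N\<close>, and so \<open>\<Sum> s\<^sub>i f(n\<^sub>i) = 0\<close>. Thus \<open>f\<close> extends to \<open>S N\<close> and then to \<open>M\<close>, that is, \<open>M\<close> is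
  quasi-injective over \<open>R\<close>. It is therefore injective over \<open>R\<close>, and then over \<open>S\<close>.
\<close>

section \<open>Relations of the tensor product\<close>

lemma keys_diff_subset:
  "Poly_Mapping.keys a \<subseteq> A \<Longrightarrow> Poly_Mapping.keys b \<subseteq> A \<Longrightarrow> Poly_Mapping.keys (a - b) \<subseteq> A"
  using keys_diff[of a b] by blast

lemma keys_add_subset:
  "Poly_Mapping.keys a \<subseteq> A \<Longrightarrow> Poly_Mapping.keys b \<subseteq> A \<Longrightarrow> Poly_Mapping.keys (a + b) \<subseteq> A"
  using keys_add[of a b] by blast

lemma diff_in_free_Abelian_group:
  "\<lbrakk>a \<in> carrier (free_Abelian_group A); b \<in> carrier (free_Abelian_group A)\<rbrakk>
    \<Longrightarrow> a - b \<in> carrier (free_Abelian_group A)"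
  by (simp add: keys_diff_subset)

lemma keys_frag_extend_of:
  assumes "Poly_Mapping.keys c \<subseteq> A" and "\<And>x. x \<in> A \<Longrightarrow> k x \<in> B"
  shows "Poly_Mapping.keys (frag_extend (frag_of \<circ> k) c) \<subseteq> B"
proof -
  have "(\<Union>x\<in>Poly_Mapping.keys c. Poly_Mapping.keys ((frag_of \<circ> k) x)) \<subseteq> B"
    using assms by auto
  then show ?thesis
    using keys_frag_extend[of "frag_of \<circ> k" c] by (rule order_trans[rotated])
qed

text \<open>Calculations in the tensor product of \<open>P\<close> and \<open>M\<close> take place
  on formal sums modulo the subgroup \<open>rels\<close>: two sums represent the same tensor iff
  their difference lies in \<open>rels\<close>. The cosets that form \<open>tensor\<close> itself
  enter only where flatness is used.\<close>

locale tensor_pair = P: right_module R P + M: left_module R M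
  for R :: "('a, 'r) ring_scheme" and P :: "('a, 'p) module" and M :: "('a, 'm) module"
begin

abbreviation frags where "frags \<equiv> carrier (free_Abelian_group (carrier P \<times> carrier M))"
abbreviation rels where "rels \<equiv> tensor_relations R P M"

lemma rels_subgroup: "subgroup rels (free_Abelian_group (carrier P \<times> carrier M))"
  unfolding tensor_relations_def
proof (rule group.generate_is_subgroup[OF group_free_Abelian_group])
qed (intro Un_least subsetI; elim CollectE exE conjE; hypsubst;
    intro diff_in_free_Abelian_group; simp add: P.smult_closed M.smult_closed)

lemma rels_subset: "rels \<subseteq> frags"
  using rels_subgroup by (rule subgroup.subset)

lemma rels_keys: "c \<in> rels \<Longrightarrow> Poly_Mapping.keys c \<subseteq> carrier P \<times> carrier M"
  using subsetD[OF rels_subset, of c] by simp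

lemma rels_zero: "0 \<in> rels"
  using subgroup.one_closed[OF rels_subgroup] by simp

lemma rels_add: "a \<in> rels \<Longrightarrow> b \<in> rels \<Longrightarrow> a + b \<in> rels"
  using subgroup.m_closed[OF rels_subgroup, of a b] by simp

lemma rels_minus: "a \<in> rels \<Longrightarrow> - a \<in> rels"
  using subgroup.m_inv_closed[OF rels_subgroup, of a] rels_keys[of a] by simp

lemma rels_diff: "a \<in> rels \<Longrightarrow> b \<in> rels \<Longrightarrow> a - b \<in> rels"
  using rels_add[OF _ rels_minus, of a b] by simp

lemma rels_distrib_left:
  assumes "p \<in> carrier P" "q \<in> carrier P" "x \<in> carrier M"
  shows "frag_of (p \<oplus>\<^bsub>P\<^esub> q, x) - frag_of (p, x) - frag_of (q, x) \<in> rels"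
  unfolding tensor_relations_def by (rule generate.incl) (use assms in blast)

lemma rels_distrib_right:
  assumes "p \<in> carrier P" "x \<in> carrier M" "y \<in> carrier M"
  shows "frag_of (p, x \<oplus>\<^bsub>M\<^esub> y) - frag_of (p, x) - frag_of (p, y) \<in> rels"
  unfolding tensor_relations_def by (rule generate.incl) (use assms in blast)

lemma rels_balanced:
  assumes "a \<in> carrier R" "p \<in> carrier P" "x \<in> carrier M"
  shows "frag_of (a \<odot>\<^bsub>P\<^esub> p, x) - frag_of (p, a \<odot>\<^bsub>M\<^esub> x) \<in> rels"
  unfolding tensor_relations_def by (rule generate.incl) (use assms in blast)

section \<open>Universal property and functoriality of the tensor product\<close>

lemma rels_least:
  assumes "subgroup H (free_Abelian_group (carrier P \<times> carrier M))"
    and "\<And>p q x. \<lbrakk>p \<in> carrier P; q \<in> carrier P; x \<in> carrier M\<rbrakk>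
      \<Longrightarrow> frag_of (p \<oplus>\<^bsub>P\<^esub> q, x) - frag_of (p, x) - frag_of (q, x) \<in> H"
    and "\<And>p x y. \<lbrakk>p \<in> carrier P; x \<in> carrier M; y \<in> carrier M\<rbrakk>
      \<Longrightarrow> frag_of (p, x \<oplus>\<^bsub>M\<^esub> y) - frag_of (p, x) - frag_of (p, y) \<in> H"
    and "\<And>a p x. \<lbrakk>a \<in> carrier R; p \<in> carrier P; x \<in> carrier M\<rbrakk>
      \<Longrightarrow> frag_of (a \<odot>\<^bsub>P\<^esub> p, x) - frag_of (p, a \<odot>\<^bsub>M\<^esub> x) \<in> H"
  shows "rels \<subseteq> H"
  unfolding tensor_relations_def
  by (rule group.generate_subgroup_incl[OF group_free_Abelian_group _ assms(1)])
     (intro Un_least subsetI; elim CollectE exE conjE; hypsubst; rule assms; assumption)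

text \<open>Universal property of the tensor product, read on formal sums. The additive extension of
  \<open>\<beta>\<close> exists because the group of formal sums is free; its kernel is a subgroup
  that contains the generators of \<open>rels\<close>, hence all of \<open>rels\<close>. Since
  modules are records extending rings, \<open>A\<close> may be a module.\<close>

lemma balanced_extension:
  fixes A :: "('c, 'd) ring_scheme"
  assumes A: "abelian_group A"
    and cl: "\<And>p x. \<lbrakk>p \<in> carrier P; x \<in> carrier M\<rbrakk> \<Longrightarrow> \<beta> p x \<in> carrier A"
    and l: "\<And>p q x. \<lbrakk>p \<in> carrier P; q \<in> carrier P; x \<in> carrier M\<rbrakk>
      \<Longrightarrow> \<beta> (p \<oplus>\<^bsub>P\<^esub> q) x = \<beta> p x \<oplus>\<^bsub>A\<^esub> \<beta> q x"
    and r: "\<And>p x y. \<lbrakk>p \<in> carrier P; x \<in> carrier M; y \<in> carrier M\<rbrakk>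
      \<Longrightarrow> \<beta> p (x \<oplus>\<^bsub>M\<^esub> y) = \<beta> p x \<oplus>\<^bsub>A\<^esub> \<beta> p y"
    and b: "\<And>a p x. \<lbrakk>a \<in> carrier R; p \<in> carrier P; x \<in> carrier M\<rbrakk>
      \<Longrightarrow> \<beta> (a \<odot>\<^bsub>P\<^esub> p) x = \<beta> p (a \<odot>\<^bsub>M\<^esub> x)"
  obtains h where "\<And>c. c \<in> frags \<Longrightarrow> h c \<in> carrier A"
    and "\<And>c d. \<lbrakk>c \<in> frags; d \<in> frags\<rbrakk> \<Longrightarrow> h (c + d) = h c \<oplus>\<^bsub>A\<^esub> h d"
    and "\<And>c d. \<lbrakk>c \<in> frags; d \<in> frags\<rbrakk> \<Longrightarrow> h (c - d) = h c \<ominus>\<^bsub>A\<^esub> h d"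
    and "\<And>p x. \<lbrakk>p \<in> carrier P; x \<in> carrier M\<rbrakk> \<Longrightarrow> h (frag_of (p, x)) = \<beta> p x"
    and "\<And>c. c \<in> rels \<Longrightarrow> h c = \<zero>\<^bsub>A\<^esub>"
proof -
  interpret A: abelian_group A by (rule A)
  let ?F = "free_Abelian_group (carrier P \<times> carrier M)"
  have "(\<lambda>(p, x). \<beta> p x) ` (carrier P \<times> carrier M) \<subseteq> carrier (add_monoid A)"
    using cl by auto
  then obtain h where hom: "h \<in> hom ?F (add_monoid A)"
    and "\<And>z. z \<in> carrier P \<times> carrier M \<Longrightarrow> h (frag_of z) = (\<lambda>(p, x). \<beta> p x) z"
    using comm_group.free_Abelian_group_universal[OF A.a_comm_group] by blast
  then have hof: "h (frag_of (p, x)) = \<beta> p x" if "p \<in> carrier P" "x \<in> carrier M" for p x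
    using that by fastforce
  interpret h: group_hom ?F "add_monoid A" h
    using hom A.a_group by (simp add: group_hom_def group_hom_axioms_def)
  have hcl: "h c \<in> carrier A" if "c \<in> frags" for c
    using h.hom_closed[OF that] by simp
  have hadd: "h (c + d) = h c \<oplus>\<^bsub>A\<^esub> h d" if "c \<in> frags" "d \<in> frags" for c d
    using h.hom_mult[OF that] by simp
  have hdiff: "h (c - d) = h c \<ominus>\<^bsub>A\<^esub> h d" if "c \<in> frags" "d \<in> frags" for c d
  proof -
    have "h (- d) = \<ominus>\<^bsub>A\<^esub> h d"
      using h.hom_inv[OF that(2)] that(2) by (simp add: a_inv_def)
    then show ?thesis
      using hadd[of c "- d"] that by (simp add: A.minus_eq)
  qed
  have gen: "frag_of z \<in> frags \<longleftrightarrow> z \<in> carrier P \<times> carrier M" for z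
    by simp
  \<comment> \<open>Both distributivity relations have the shape \<open>u - v - w\<close>, so one
    computation serves for the two.\<close>
  have eq: "h (frag_of u - frag_of v - frag_of w) = \<zero>\<^bsub>A\<^esub>"
    if "u \<in> carrier P \<times> carrier M" "v \<in> carrier P \<times> carrier M" "w \<in> carrier P \<times> carrier M"
      "h (frag_of u) = h (frag_of v) \<oplus>\<^bsub>A\<^esub> h (frag_of w)" for u v w
  proof -
    have vw: "frag_of v + frag_of w \<in> frags"
      using that keys_add_subset[of "frag_of v" _ "frag_of w"] by simp
    have "h (frag_of u - (frag_of v + frag_of w)) = h (frag_of u) \<ominus>\<^bsub>A\<^esub> h (frag_of u)"
      using that gen vw by (metis hdiff hadd)
    then show ?thesis
      using hcl[of "frag_of u"] that(1) gen by (simp add: diff_diff_eq A.minus_eq A.r_neg)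
  qed
  have K: "rels \<subseteq> kernel ?F (add_monoid A) h"
  proof (rule rels_least[OF h.subgroup_kernel])
    fix p q x assume *: "p \<in> carrier P" "q \<in> carrier P" "x \<in> carrier M"
    then show "frag_of (p \<oplus>\<^bsub>P\<^esub> q, x) - frag_of (p, x) - frag_of (q, x) \<in> kernel ?F (add_monoid A) h"
      unfolding kernel_def using subsetD[OF rels_subset rels_distrib_left[OF *]]
      by (auto simp: hof l intro!: eq)
  next
    fix p x y assume *: "p \<in> carrier P" "x \<in> carrier M" "y \<in> carrier M"
    then show "frag_of (p, x \<oplus>\<^bsub>M\<^esub> y) - frag_of (p, x) - frag_of (p, y) \<in> kernel ?F (add_monoid A) h"
      unfolding kernel_def using subsetD[OF rels_subset rels_distrib_right[OF *]]
      by (auto simp: hof r intro!: eq)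
  next
    fix a p x assume *: "a \<in> carrier R" "p \<in> carrier P" "x \<in> carrier M"
    then have "h (frag_of (a \<odot>\<^bsub>P\<^esub> p, x) - frag_of (p, a \<odot>\<^bsub>M\<^esub> x)) = \<zero>\<^bsub>A\<^esub>"
      using P.smult_closed M.smult_closed cl by (subst hdiff) (auto simp: hof b A.minus_eq A.r_neg)
    then show "frag_of (a \<odot>\<^bsub>P\<^esub> p, x) - frag_of (p, a \<odot>\<^bsub>M\<^esub> x) \<in> kernel ?F (add_monoid A) h"
      unfolding kernel_def using subsetD[OF rels_subset rels_balanced[OF *]] by simp
  qed
  have "h c = \<zero>\<^bsub>A\<^esub>" if "c \<in> rels" for c
    using subsetD[OF K that] unfolding kernel_def by simp
  then show thesis
    using that[OF hcl hadd hdiff hof] by simp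
qed

text \<open>The preimage of the target relations under an additive map is a subgroup, so it is
  enough to look at the generators of \<open>rels\<close>. This is how a map on pairs of elements
  induces a map of tensor products; it is used for the two multiplications on
  \<open>S \<otimes> S\<close>, for \<open>S \<otimes> S \<rightarrow> S \<otimes> M\<close> and for
  the inclusion of a submodule.\<close>

lemma rels_image:
  assumes "tensor_pair R P' M'"
    and k: "\<And>p x. \<lbrakk>p \<in> carrier P; x \<in> carrier M\<rbrakk> \<Longrightarrow> k (p, x) \<in> carrier P' \<times> carrier M'"
    and "\<And>p q x. \<lbrakk>p \<in> carrier P; q \<in> carrier P; x \<in> carrier M\<rbrakk>
      \<Longrightarrow> frag_of (k (p \<oplus>\<^bsub>P\<^esub> q, x)) - frag_of (k (p, x)) - frag_of (k (q, x))
        \<in> tensor_relations R P' M'"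
    and "\<And>p x y. \<lbrakk>p \<in> carrier P; x \<in> carrier M; y \<in> carrier M\<rbrakk>
      \<Longrightarrow> frag_of (k (p, x \<oplus>\<^bsub>M\<^esub> y)) - frag_of (k (p, x)) - frag_of (k (p, y))
        \<in> tensor_relations R P' M'"
    and "\<And>a p x. \<lbrakk>a \<in> carrier R; p \<in> carrier P; x \<in> carrier M\<rbrakk>
      \<Longrightarrow> frag_of (k (a \<odot>\<^bsub>P\<^esub> p, x)) - frag_of (k (p, a \<odot>\<^bsub>M\<^esub> x)) \<in> tensor_relations R P' M'"
    and "c \<in> rels"
  shows "frag_extend (frag_of \<circ> k) c \<in> tensor_relations R P' M'"
proof -
  interpret T: tensor_pair R P' M' by (rule assms)
  let ?H = "{c \<in> frags. frag_extend (frag_of \<circ> k) c \<in> T.rels}"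
  have K: "rels \<subseteq> ?H"
  proof (rule rels_least)
    show "subgroup ?H (free_Abelian_group (carrier P \<times> carrier M))"
    proof (rule subgroup.intro)
      show "?H \<subseteq> frags"
        by blast
      fix c d assume "c \<in> ?H" "d \<in> ?H"
      then show "c \<otimes>\<^bsub>free_Abelian_group (carrier P \<times> carrier M)\<^esub> d \<in> ?H"
        by (simp add: frag_extend_add T.rels_add keys_add_subset)
    qed (simp_all add: frag_extend_minus T.rels_zero T.rels_minus)
  next
    fix p q x assume *: "p \<in> carrier P" "q \<in> carrier P" "x \<in> carrier M"
    then show "frag_of (p \<oplus>\<^bsub>P\<^esub> q, x) - frag_of (p, x) - frag_of (q, x) \<in> ?H"
      using assms(3)[OF *] subsetD[OF rels_subset rels_distrib_left[OF *]]
      by (simp add: frag_extend_diff)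
  next
    fix p x y assume *: "p \<in> carrier P" "x \<in> carrier M" "y \<in> carrier M"
    then show "frag_of (p, x \<oplus>\<^bsub>M\<^esub> y) - frag_of (p, x) - frag_of (p, y) \<in> ?H"
      using assms(4)[OF *] subsetD[OF rels_subset rels_distrib_right[OF *]]
      by (simp add: frag_extend_diff)
  next
    fix a p x assume *: "a \<in> carrier R" "p \<in> carrier P" "x \<in> carrier M"
    then show "frag_of (a \<odot>\<^bsub>P\<^esub> p, x) - frag_of (p, a \<odot>\<^bsub>M\<^esub> x) \<in> ?H"
      using assms(5)[OF *] subsetD[OF rels_subset rels_balanced[OF *]]
      by (simp add: frag_extend_diff)
  qed
  show ?thesis
    using subsetD[OF K assms(6)] by simp
qed

end

section \<open>Restriction of scalars\<close>

text \<open>\<open>abelian_group\<close> reads only the carrier, \<open>add\<close> and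
  \<open>zero\<close>, so the property passes between records that differ in their other fields. It
  serves all three restrictions of scalars below.\<close>

lemma abelian_group_of_eq:
  assumes "abelian_group A" "carrier B = carrier A" "add B = add A" "\<zero>\<^bsub>B\<^esub> = \<zero>\<^bsub>A\<^esub>"
  shows "abelian_group B"
proof -
  interpret A: abelian_group A by (rule assms)
  show ?thesis
    by (rule abelian_groupI) (use assms(2-4) A.l_neg in \<open>auto simp: A.a_ac\<close>)
qed

lemma left_via_simps [simp]:
  "carrier (left_via S \<phi>) = carrier S" "add (left_via S \<phi>) = add S"
  "\<zero>\<^bsub>left_via S \<phi>\<^esub> = \<zero>\<^bsub>S\<^esub>" "smult (left_via S \<phi>) = (\<lambda>a s. \<phi> a \<otimes>\<^bsub>S\<^esub> s)"
  by (simp_all add: left_via_def)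

lemma right_via_simps [simp]:
  "carrier (right_via S \<phi>) = carrier S" "add (right_via S \<phi>) = add S"
  "\<zero>\<^bsub>right_via S \<phi>\<^esub> = \<zero>\<^bsub>S\<^esub>" "smult (right_via S \<phi>) = (\<lambda>a s. s \<otimes>\<^bsub>S\<^esub> \<phi> a)"
  by (simp_all add: right_via_def)

definition restrict_scalars :: "('a \<Rightarrow> 's) \<Rightarrow> ('s, 'm) module \<Rightarrow> ('a, 'm) module" where
  "restrict_scalars \<phi> M = \<lparr>carrier = carrier M, monoid.mult = monoid.mult M,
     monoid.one = monoid.one M, ring.zero = ring.zero M, add = add M,
     smult = (\<lambda>a x. \<phi> a \<odot>\<^bsub>M\<^esub> x)\<rparr>"

lemma restrict_scalars_simps [simp]:
  "carrier (restrict_scalars \<phi> M) = carrier M" "add (restrict_scalars \<phi> M) = add M"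
  "\<zero>\<^bsub>restrict_scalars \<phi> M\<^esub> = \<zero>\<^bsub>M\<^esub>" "smult (restrict_scalars \<phi> M) = (\<lambda>a x. \<phi> a \<odot>\<^bsub>M\<^esub> x)"
  by (simp_all add: restrict_scalars_def)

locale change_of_rings = R: ring R + S: ring S
  for R :: "('a, 'r) ring_scheme" and S :: "('s, 'z) ring_scheme" +
  fixes \<psi> :: "'a \<Rightarrow> 's"
  assumes ring_hom: "\<psi> \<in> ring_hom R S"
begin

lemma hom_closed: "a \<in> carrier R \<Longrightarrow> \<psi> a \<in> carrier S"
  using ring_hom_memE(1)[OF ring_hom] .

lemmas hom_mult = ring_hom_memE(2)[OF ring_hom]
  and hom_add = ring_hom_memE(3)[OF ring_hom]
  and hom_one = ring_hom_memE(4)[OF ring_hom]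

lemma right_module_right_via: "right_module R (right_via S \<psi>)"
  unfolding right_module_def right_module_axioms_def
  using R.ring_axioms abelian_group_of_eq[OF S.is_abelian_group, of "right_via S \<psi>"]
  by (simp add: hom_closed hom_mult hom_add hom_one S.l_distr S.r_distr S.m_assoc)

lemma left_module_left_via: "left_module R (left_via S \<psi>)"
  unfolding left_module_def left_module_axioms_def
  using R.ring_axioms abelian_group_of_eq[OF S.is_abelian_group, of "left_via S \<psi>"]
  by (simp add: hom_closed hom_mult hom_add hom_one S.l_distr S.r_distr S.m_assoc)

lemma left_module_restrict_scalars:
  assumes "left_module S M"
  shows "left_module R (restrict_scalars \<psi> M)"
proof -
  interpret M: left_module S M by (rule assms)
  show ?thesis
    unfolding left_module_def left_module_axioms_def
    using R.ring_axioms abelian_group_of_eq[OF M.abelian_group_axioms, of "restrict_scalars \<psi> M"]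
    by (simp add: hom_closed hom_mult hom_add hom_one M.smult_closed M.smult_l_distr
        M.smult_r_distr M.smult_assoc M.smult_one)
qed

end

section \<open>Epimorphisms and the tensor square\<close>

text \<open>\<open>SS\<close> pairs \<open>S\<close> as a right \<open>R\<close>-module with
  \<open>S\<close> as a left \<open>R\<close>-module: formal sums modulo \<open>SS.rels\<close> are
  the tensor square of \<open>S\<close> over \<open>R\<close>.\<close>

sublocale change_of_rings \<subseteq> SS: tensor_pair R "right_via S \<psi>" "left_via S \<psi>"
  by (intro tensor_pair.intro right_module_right_via left_module_left_via)

definition (in tensor_pair) cls where "cls c = (SOME d. c - d \<in> rels)"

lemma (in tensor_pair) diff_cls_in_rels: "c - cls c \<in> rels"
  unfolding cls_def by (rule someI[of _ c]) (simp add: rels_zero)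

text \<open>For congruent sums the predicates behind the two choices coincide, hence so do the
  chosen sums. Thus \<open>cls\<close> picks one representative per coset.\<close>

lemma (in tensor_pair) cls_eq_iff: "cls c = cls d \<longleftrightarrow> c - d \<in> rels"
proof
  assume "cls c = cls d"
  then show "c - d \<in> rels"
    using rels_diff[OF diff_cls_in_rels[of c] diff_cls_in_rels[of d]] by simp
next
  assume cd: "c - d \<in> rels"
  have "c - x \<in> rels \<longleftrightarrow> d - x \<in> rels" for x
    using rels_add[OF cd, of "d - x"] rels_diff[OF _ cd, of "c - x"] by auto
  then show "cls c = cls d"
    unfolding cls_def by simp
qed

section \<open>The bimodule structure of the tensor square\<close>

context change_of_rings
begin

text \<open>Left multiplication on the first factor and right multiplication on the second, lifted
  to formal sums. The unit, associativity and commutation laws hold exactly for formal sums, but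
  additivity in the scalar holds only modulo \<open>SS.rels\<close>, because the pair with first
  entry \<open>(s + t) x\<close> is a generator of its own.\<close>

abbreviation lact where "lact s \<equiv> frag_extend (frag_of \<circ> (\<lambda>(x, y). (s \<otimes>\<^bsub>S\<^esub> x, y)))"
abbreviation ract where "ract t \<equiv> frag_extend (frag_of \<circ> (\<lambda>(x, y). (x, y \<otimes>\<^bsub>S\<^esub> t)))"

lemma frags_zero: "0 \<in> SS.frags"
  by simp

lemma frags_add: "\<lbrakk>c \<in> SS.frags; d \<in> SS.frags\<rbrakk> \<Longrightarrow> c + d \<in> SS.frags"
  by (simp add: keys_add_subset)

lemma lact_frags: "\<lbrakk>s \<in> carrier S; c \<in> SS.frags\<rbrakk> \<Longrightarrow> lact s c \<in> SS.frags"
  unfolding carrier_free_Abelian_group_iff left_via_simps right_via_simps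
  by (rule keys_frag_extend_of) auto

lemma ract_frags: "\<lbrakk>s \<in> carrier S; c \<in> SS.frags\<rbrakk> \<Longrightarrow> ract s c \<in> SS.frags"
  unfolding carrier_free_Abelian_group_iff left_via_simps right_via_simps
  by (rule keys_frag_extend_of) auto

text \<open>Left multiplication by \<open>s\<close> commutes with the right action of
  \<open>R\<close> on the first factor by associativity, so it respects the balancing relation and
  descends to the tensor square.\<close>

lemma lact_rels:
  assumes s: "s \<in> carrier S" and c: "c \<in> SS.rels"
  shows "lact s c \<in> SS.rels"
proof (rule SS.rels_image[OF SS.tensor_pair_axioms _ _ _ _ c])
  show "frag_of (case (p \<oplus>\<^bsub>right_via S \<psi>\<^esub> q, x) of (x, y) \<Rightarrow> (s \<otimes>\<^bsub>S\<^esub> x, y))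
      - frag_of (case (p, x) of (x, y) \<Rightarrow> (s \<otimes>\<^bsub>S\<^esub> x, y))
      - frag_of (case (q, x) of (x, y) \<Rightarrow> (s \<otimes>\<^bsub>S\<^esub> x, y)) \<in> SS.rels"
    if "p \<in> carrier (right_via S \<psi>)" "q \<in> carrier (right_via S \<psi>)" "x \<in> carrier (left_via S \<psi>)"
    for p q x
    using that s SS.rels_distrib_left[of "s \<otimes>\<^bsub>S\<^esub> p" "s \<otimes>\<^bsub>S\<^esub> q" x] by (simp add: S.r_distr)
  show "frag_of (case (p, x \<oplus>\<^bsub>left_via S \<psi>\<^esub> y) of (x, y) \<Rightarrow> (s \<otimes>\<^bsub>S\<^esub> x, y))
      - frag_of (case (p, x) of (x, y) \<Rightarrow> (s \<otimes>\<^bsub>S\<^esub> x, y))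
      - frag_of (case (p, y) of (x, y) \<Rightarrow> (s \<otimes>\<^bsub>S\<^esub> x, y)) \<in> SS.rels"
    if "p \<in> carrier (right_via S \<psi>)" "x \<in> carrier (left_via S \<psi>)" "y \<in> carrier (left_via S \<psi>)"
    for p x y
    using that s SS.rels_distrib_right[of "s \<otimes>\<^bsub>S\<^esub> p" x y] by simp
  show "frag_of (case (a \<odot>\<^bsub>right_via S \<psi>\<^esub> p, x) of (x, y) \<Rightarrow> (s \<otimes>\<^bsub>S\<^esub> x, y))
      - frag_of (case (p, a \<odot>\<^bsub>left_via S \<psi>\<^esub> x) of (x, y) \<Rightarrow> (s \<otimes>\<^bsub>S\<^esub> x, y)) \<in> SS.rels"
    if "a \<in> carrier R" "p \<in> carrier (right_via S \<psi>)" "x \<in> carrier (left_via S \<psi>)" for a p x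
    using that s SS.rels_balanced[of a "s \<otimes>\<^bsub>S\<^esub> p" x] by (simp add: S.m_assoc hom_closed)
qed (use s in auto)

lemma ract_rels:
  assumes s: "s \<in> carrier S" and c: "c \<in> SS.rels"
  shows "ract s c \<in> SS.rels"
proof (rule SS.rels_image[OF SS.tensor_pair_axioms _ _ _ _ c])
  show "frag_of (case (p \<oplus>\<^bsub>right_via S \<psi>\<^esub> q, x) of (x, y) \<Rightarrow> (x, y \<otimes>\<^bsub>S\<^esub> s))
      - frag_of (case (p, x) of (x, y) \<Rightarrow> (x, y \<otimes>\<^bsub>S\<^esub> s))
      - frag_of (case (q, x) of (x, y) \<Rightarrow> (x, y \<otimes>\<^bsub>S\<^esub> s)) \<in> SS.rels"
    if "p \<in> carrier (right_via S \<psi>)" "q \<in> carrier (right_via S \<psi>)" "x \<in> carrier (left_via S \<psi>)"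
    for p q x
    using that s SS.rels_distrib_left[of p q "x \<otimes>\<^bsub>S\<^esub> s"] by simp
  show "frag_of (case (p, x \<oplus>\<^bsub>left_via S \<psi>\<^esub> y) of (x, y) \<Rightarrow> (x, y \<otimes>\<^bsub>S\<^esub> s))
      - frag_of (case (p, x) of (x, y) \<Rightarrow> (x, y \<otimes>\<^bsub>S\<^esub> s))
      - frag_of (case (p, y) of (x, y) \<Rightarrow> (x, y \<otimes>\<^bsub>S\<^esub> s)) \<in> SS.rels"
    if "p \<in> carrier (right_via S \<psi>)" "x \<in> carrier (left_via S \<psi>)" "y \<in> carrier (left_via S \<psi>)"
    for p x y
    using that s SS.rels_distrib_right[of p "x \<otimes>\<^bsub>S\<^esub> s" "y \<otimes>\<^bsub>S\<^esub> s"] by (simp add: S.l_distr)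
  show "frag_of (case (a \<odot>\<^bsub>right_via S \<psi>\<^esub> p, x) of (x, y) \<Rightarrow> (x, y \<otimes>\<^bsub>S\<^esub> s))
      - frag_of (case (p, a \<odot>\<^bsub>left_via S \<psi>\<^esub> x) of (x, y) \<Rightarrow> (x, y \<otimes>\<^bsub>S\<^esub> s)) \<in> SS.rels"
    if "a \<in> carrier R" "p \<in> carrier (right_via S \<psi>)" "x \<in> carrier (left_via S \<psi>)" for a p x
    using that s SS.rels_balanced[of a p "x \<otimes>\<^bsub>S\<^esub> s"] by (simp add: S.m_assoc hom_closed)
qed (use s in auto)

lemma lact_add_rels:
  assumes "s \<in> carrier S" "t \<in> carrier S" "c \<in> SS.frags"
  shows "lact (s \<oplus>\<^bsub>S\<^esub> t) c - (lact s c + lact t c) \<in> SS.rels"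
proof -
  have "Poly_Mapping.keys c \<subseteq> carrier S \<times> carrier S" using assms(3) by simp
  then show ?thesis
  proof (induction c rule: frag_induction)
    case (one z)
    then show ?case
      using assms SS.rels_distrib_left[of "s \<otimes>\<^bsub>S\<^esub> fst z" "t \<otimes>\<^bsub>S\<^esub> fst z" "snd z"]
      by (auto simp: S.l_distr diff_diff_eq)
  next
    case (diff a b)
    then show ?case
      using SS.rels_diff[OF diff] by (simp add: frag_extend_diff algebra_simps)
  qed (simp add: SS.rels_zero)
qed

lemma ract_add_rels:
  assumes "s \<in> carrier S" "t \<in> carrier S" "c \<in> SS.frags"
  shows "ract (s \<oplus>\<^bsub>S\<^esub> t) c - (ract s c + ract t c) \<in> SS.rels"
proof -
  have "Poly_Mapping.keys c \<subseteq> carrier S \<times> carrier S" using assms(3) by simp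
  then show ?thesis
  proof (induction c rule: frag_induction)
    case (one z)
    then show ?case
      using assms SS.rels_distrib_right[of "fst z" "snd z \<otimes>\<^bsub>S\<^esub> s" "snd z \<otimes>\<^bsub>S\<^esub> t"]
      by (auto simp: S.r_distr diff_diff_eq)
  next
    case (diff a b)
    then show ?case
      using SS.rels_diff[OF diff] by (simp add: frag_extend_diff algebra_simps)
  qed (simp add: SS.rels_zero)
qed

lemma
  assumes "c \<in> SS.frags"
  shows lact_one: "lact \<one>\<^bsub>S\<^esub> c = c"
    and ract_one: "ract \<one>\<^bsub>S\<^esub> c = c"
    and lact_lact: "\<lbrakk>s \<in> carrier S; t \<in> carrier S\<rbrakk> \<Longrightarrow> lact s (lact t c) = lact (s \<otimes>\<^bsub>S\<^esub> t) c"
    and ract_ract: "\<lbrakk>s \<in> carrier S; t \<in> carrier S\<rbrakk> \<Longrightarrow> ract s (ract t c) = ract (t \<otimes>\<^bsub>S\<^esub> s) c"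
    and lact_ract: "lact s (ract t c) = ract t (lact s c)"
proof -
  have "Poly_Mapping.keys c \<subseteq> carrier S \<times> carrier S" using assms by simp
  then have "lact \<one>\<^bsub>S\<^esub> c = c \<and> ract \<one>\<^bsub>S\<^esub> c = c
      \<and> (s \<in> carrier S \<and> t \<in> carrier S \<longrightarrow> lact s (lact t c) = lact (s \<otimes>\<^bsub>S\<^esub> t) c)
      \<and> (s \<in> carrier S \<and> t \<in> carrier S \<longrightarrow> ract s (ract t c) = ract (t \<otimes>\<^bsub>S\<^esub> s) c)
      \<and> lact s (ract t c) = ract t (lact s c)" for s t
  proof (induction c rule: frag_induction)
    case (one z)
    then show ?case by (auto simp: S.m_assoc)
  next
    case (diff a b)
    then show ?case by (auto simp: frag_extend_diff)
  qed simp
  then show "lact \<one>\<^bsub>S\<^esub> c = c" "ract \<one>\<^bsub>S\<^esub> c = c"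
    "\<lbrakk>s \<in> carrier S; t \<in> carrier S\<rbrakk> \<Longrightarrow> lact s (lact t c) = lact (s \<otimes>\<^bsub>S\<^esub> t) c"
    "\<lbrakk>s \<in> carrier S; t \<in> carrier S\<rbrakk> \<Longrightarrow> ract s (ract t c) = ract (t \<otimes>\<^bsub>S\<^esub> s) c"
    "lact s (ract t c) = ract t (lact s c)"
    by blast+
qed

text \<open>The trivial extension of \<open>S\<close> by the bimodule \<open>S \<otimes>\<^sub>R S\<close>. Classes are given by chosen
  representatives rather than by cosets, so that the carrier fits in the universe.\<close>

definition trivial_extension :: "('s \<times> ('s \<times> 's \<Rightarrow>\<^sub>0 int)) ring" where
  "trivial_extension = \<lparr>carrier = carrier S \<times> SS.cls ` SS.frags,
     monoid.mult = (\<lambda>(s, c) (t, d). (s \<otimes>\<^bsub>S\<^esub> t, SS.cls (lact s d + ract t c))),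
     monoid.one = (\<one>\<^bsub>S\<^esub>, SS.cls 0), ring.zero = (\<zero>\<^bsub>S\<^esub>, SS.cls 0),
     add = (\<lambda>(s, c) (t, d). (s \<oplus>\<^bsub>S\<^esub> t, SS.cls (c + d)))\<rparr>"

lemma trivial_extension_simps [simp]:
  "\<one>\<^bsub>trivial_extension\<^esub> = (\<one>\<^bsub>S\<^esub>, SS.cls 0)" "\<zero>\<^bsub>trivial_extension\<^esub> = (\<zero>\<^bsub>S\<^esub>, SS.cls 0)"
  by (simp_all add: trivial_extension_def)

lemma trivial_extension_carrier [simp]:
  "x \<in> carrier trivial_extension \<longleftrightarrow> (\<exists>s\<in>carrier S. \<exists>c\<in>SS.frags. x = (s, SS.cls c))"
  by (auto simp: trivial_extension_def)

text \<open>The definition adds the chosen representatives. Replacing them by arbitrary ones changes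
  the sum only by a relation.\<close>

lemma trivial_extension_add:
  "(s, SS.cls c) \<oplus>\<^bsub>trivial_extension\<^esub> (t, SS.cls d) = (s \<oplus>\<^bsub>S\<^esub> t, SS.cls (c + d))"
proof -
  have "SS.cls c + SS.cls d - (c + d) \<in> SS.rels"
    using SS.rels_minus[OF SS.rels_add[OF SS.diff_cls_in_rels[of c] SS.diff_cls_in_rels[of d]]]
    by (simp add: algebra_simps)
  then show ?thesis
    by (simp add: trivial_extension_def SS.cls_eq_iff)
qed

text \<open>Representatives may again be arbitrary, now because \<open>lact s\<close> and
  \<open>ract t\<close> preserve \<open>SS.rels\<close>, which requires \<open>s\<close> and
  \<open>t\<close> to lie in \<open>S\<close>.\<close>

lemma trivial_extension_mult:
  assumes "s \<in> carrier S" "t \<in> carrier S"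
  shows "(s, SS.cls c) \<otimes>\<^bsub>trivial_extension\<^esub> (t, SS.cls d)
    = (s \<otimes>\<^bsub>S\<^esub> t, SS.cls (lact s d + ract t c))"
proof -
  have "lact s (SS.cls d) + ract t (SS.cls c) - (lact s d + ract t c) \<in> SS.rels"
    using SS.rels_minus[OF SS.rels_add[OF lact_rels[OF assms(1) SS.diff_cls_in_rels[of d]]
        ract_rels[OF assms(2) SS.diff_cls_in_rels[of c]]]]
    by (simp add: frag_extend_diff algebra_simps)
  then show ?thesis
    by (simp add: trivial_extension_def SS.cls_eq_iff)
qed

lemma ring_trivial_extension: "ring trivial_extension"
proof (rule ringI)
  show "abelian_group trivial_extension"
  proof (rule abelian_groupI)
    fix x assume "x \<in> carrier trivial_extension"
    then obtain s c where x: "s \<in> carrier S" "c \<in> SS.frags" "x = (s, SS.cls c)" by auto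
    then show "\<zero>\<^bsub>trivial_extension\<^esub> \<oplus>\<^bsub>trivial_extension\<^esub> x = x"
      by (simp add: trivial_extension_add)
    show "\<exists>y\<in>carrier trivial_extension. y \<oplus>\<^bsub>trivial_extension\<^esub> x = \<zero>\<^bsub>trivial_extension\<^esub>"
    proof (rule bexI)
      show "(\<ominus>\<^bsub>S\<^esub> s, SS.cls (- c)) \<in> carrier trivial_extension"
        using x by auto
    qed (use x in \<open>simp add: trivial_extension_add S.l_neg\<close>)
  next
    fix x y assume "x \<in> carrier trivial_extension" "y \<in> carrier trivial_extension"
    then obtain s c t d where "s \<in> carrier S" "c \<in> SS.frags" "x = (s, SS.cls c)"
      "t \<in> carrier S" "d \<in> SS.frags" "y = (t, SS.cls d)" by auto
    then show "x \<oplus>\<^bsub>trivial_extension\<^esub> y \<in> carrier trivial_extension"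
      using frags_add[of c d]
      by (auto simp: trivial_extension_add simp del: carrier_free_Abelian_group_iff)
  qed (use frags_zero in \<open>auto simp: trivial_extension_add S.a_ac add_ac
      simp del: carrier_free_Abelian_group_iff\<close>)
next
  show "monoid trivial_extension"
  proof (rule monoidI)
    show "\<one>\<^bsub>trivial_extension\<^esub> \<in> carrier trivial_extension"
      by auto
  next
    fix x y assume "x \<in> carrier trivial_extension" "y \<in> carrier trivial_extension"
    then obtain s c t d where "s \<in> carrier S" "c \<in> SS.frags" "x = (s, SS.cls c)"
      "t \<in> carrier S" "d \<in> SS.frags" "y = (t, SS.cls d)" by auto
    then show "x \<otimes>\<^bsub>trivial_extension\<^esub> y \<in> carrier trivial_extension"
      using frags_add[OF lact_frags ract_frags, of s d t c]
      by (auto simp: trivial_extension_mult simp del: carrier_free_Abelian_group_iff)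
  next
    fix x y z assume "x \<in> carrier trivial_extension" "y \<in> carrier trivial_extension"
      "z \<in> carrier trivial_extension"
    then obtain s c t d u e where "s \<in> carrier S" "c \<in> SS.frags" "x = (s, SS.cls c)"
      "t \<in> carrier S" "d \<in> SS.frags" "y = (t, SS.cls d)"
      "u \<in> carrier S" "e \<in> SS.frags" "z = (u, SS.cls e)" by auto
    then show "x \<otimes>\<^bsub>trivial_extension\<^esub> y \<otimes>\<^bsub>trivial_extension\<^esub> z
        = x \<otimes>\<^bsub>trivial_extension\<^esub> (y \<otimes>\<^bsub>trivial_extension\<^esub> z)"
      by (simp add: trivial_extension_mult S.m_assoc frag_extend_add lact_lact ract_ract lact_ract
          add_ac del: carrier_free_Abelian_group_iff)
  next
    fix x assume "x \<in> carrier trivial_extension"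
    then obtain s c where "s \<in> carrier S" "c \<in> SS.frags" "x = (s, SS.cls c)" by auto
    then show "\<one>\<^bsub>trivial_extension\<^esub> \<otimes>\<^bsub>trivial_extension\<^esub> x = x"
      "x \<otimes>\<^bsub>trivial_extension\<^esub> \<one>\<^bsub>trivial_extension\<^esub> = x"
      by (simp_all add: trivial_extension_mult lact_one ract_one
          del: carrier_free_Abelian_group_iff)
  qed
next
  fix x y z assume "x \<in> carrier trivial_extension" "y \<in> carrier trivial_extension"
    "z \<in> carrier trivial_extension"
  then obtain s c t d u e where *: "s \<in> carrier S" "c \<in> SS.frags" "x = (s, SS.cls c)"
    "t \<in> carrier S" "d \<in> SS.frags" "y = (t, SS.cls d)"
    "u \<in> carrier S" "e \<in> SS.frags" "z = (u, SS.cls e)" by auto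
  \<comment> \<open>Unlike associativity, distributivity is not an identity of formal sums: it uses
    additivity of the actions in the scalar, modulo relations.\<close>
  have "lact (s \<oplus>\<^bsub>S\<^esub> t) e + ract u (c + d) - (lact s e + ract u c + (lact t e + ract u d)) \<in> SS.rels"
    using lact_add_rels[of s t e] * by (simp add: frag_extend_add algebra_simps
        del: carrier_free_Abelian_group_iff)
  then show "(x \<oplus>\<^bsub>trivial_extension\<^esub> y) \<otimes>\<^bsub>trivial_extension\<^esub> z
      = x \<otimes>\<^bsub>trivial_extension\<^esub> z \<oplus>\<^bsub>trivial_extension\<^esub> y \<otimes>\<^bsub>trivial_extension\<^esub> z"
    using * by (simp add: trivial_extension_add trivial_extension_mult S.l_distr SS.cls_eq_iff)
  have "lact u (c + d) + ract (s \<oplus>\<^bsub>S\<^esub> t) e - (lact u c + ract s e + (lact u d + ract t e)) \<in> SS.rels"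
    using ract_add_rels[of s t e] * by (simp add: frag_extend_add algebra_simps
        del: carrier_free_Abelian_group_iff)
  then show "z \<otimes>\<^bsub>trivial_extension\<^esub> (x \<oplus>\<^bsub>trivial_extension\<^esub> y)
      = z \<otimes>\<^bsub>trivial_extension\<^esub> x \<oplus>\<^bsub>trivial_extension\<^esub> z \<otimes>\<^bsub>trivial_extension\<^esub> y"
    using * by (simp add: trivial_extension_add trivial_extension_mult S.r_distr SS.cls_eq_iff)
qed

lemma trivial_extension_incl: "(\<lambda>s. (s, SS.cls 0)) \<in> ring_hom S trivial_extension"
  by (rule ring_hom_memI) (auto simp: trivial_extension_add trivial_extension_mult)

text \<open>The inner derivation of \<open>1 \<otimes> 1\<close> vanishes on \<open>R\<close>; it gives a second ring homomorphism that
  agrees with the inclusion on \<open>R\<close>.\<close>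

abbreviation derivation where "derivation s \<equiv> frag_of (s, \<one>\<^bsub>S\<^esub>) - frag_of (\<one>\<^bsub>S\<^esub>, s)"

lemma trivial_extension_twist: "(\<lambda>s. (s, SS.cls (derivation s))) \<in> ring_hom S trivial_extension"
proof (rule ring_hom_memI)
  fix s assume "s \<in> carrier S"
  then show "(s, SS.cls (derivation s)) \<in> carrier trivial_extension"
    using diff_in_free_Abelian_group[of "frag_of (s, \<one>\<^bsub>S\<^esub>)" _ "frag_of (\<one>\<^bsub>S\<^esub>, s)"]
    by (auto simp del: carrier_free_Abelian_group_iff)
next
  fix s t assume *: "s \<in> carrier S" "t \<in> carrier S"
  \<comment> \<open>In \<open>s (t \<otimes> 1 - 1 \<otimes> t) + (s \<otimes> 1 - 1 \<otimes> s)
    t\<close> the two terms \<open>s \<otimes> t\<close> cancel, already as formal sums.\<close>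
  then show "(s \<otimes>\<^bsub>S\<^esub> t, SS.cls (derivation (s \<otimes>\<^bsub>S\<^esub> t)))
      = (s, SS.cls (derivation s)) \<otimes>\<^bsub>trivial_extension\<^esub> (t, SS.cls (derivation t))"
    by (simp add: trivial_extension_mult frag_extend_diff)
  have "derivation (s \<oplus>\<^bsub>S\<^esub> t) - (derivation s + derivation t) \<in> SS.rels"
    using SS.rels_diff[OF SS.rels_distrib_left[of s t "\<one>\<^bsub>S\<^esub>"] SS.rels_distrib_right[of "\<one>\<^bsub>S\<^esub>" s t]] *
    by (simp add: algebra_simps)
  then show "(s \<oplus>\<^bsub>S\<^esub> t, SS.cls (derivation (s \<oplus>\<^bsub>S\<^esub> t)))
      = (s, SS.cls (derivation s)) \<oplus>\<^bsub>trivial_extension\<^esub> (t, SS.cls (derivation t))"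
    by (simp add: trivial_extension_add SS.cls_eq_iff)
qed simp

end

text \<open>An infinite set is equipotent to its square and to the free abelian group on that
  square. Hence the trivial extension, whose elements are pairs of a ring element and a formal sum,
  embeds into an infinite universe.\<close>

lemma lepoll_frag_times:
  assumes "infinite (UNIV :: 'u set)"
  shows "(UNIV :: ('u \<times> ('u \<times> 'u \<Rightarrow>\<^sub>0 int)) set) \<lesssim> (UNIV :: 'u set)"
proof -
  have sq: "(UNIV :: ('u \<times> 'u) set) \<approx> (UNIV :: 'u set)"
    using card_of_Times_same_infinite[OF assms]
    by (simp add: eqpoll_iff_card_of_ordIso)
  then have "infinite (UNIV :: ('u \<times> 'u) set)"
    using assms eqpoll_finite_iff by blast
  then have "(UNIV :: ('u \<times> 'u \<Rightarrow>\<^sub>0 int) set) \<approx> (UNIV :: ('u \<times> 'u) set)"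
    using eqpoll_free_Abelian_group_infinite by (fastforce simp: free_Abelian_group_def)
  then have "(UNIV :: ('u \<times> 'u \<Rightarrow>\<^sub>0 int) set) \<approx> (UNIV :: 'u set)"
    using sq eqpoll_trans by blast
  then have "(UNIV :: 'u set) \<times> (UNIV :: ('u \<times> 'u \<Rightarrow>\<^sub>0 int) set) \<lesssim> (UNIV :: 'u set) \<times> (UNIV :: 'u set)"
    by (intro times_lepoll_mono eqpoll_imp_lepoll eqpoll_refl)
  then show ?thesis
    using sq lepoll_trans2 by fastforce
qed

text \<open>\<open>ring_epimorphism\<close> tests only rings with elements in \<open>'u\<close>. A
  ring \<open>T\<close> over another type is replaced by its image under the injection
  \<open>e\<close>, which carries an isomorphic ring structure.\<close>

lemma ring_epimorphism_cancel:
  fixes T :: "'t ring" and e :: "'t \<Rightarrow> 'u"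
  assumes epi: "ring_epimorphism TYPE('u) R S \<psi>" and T: "ring T" and e: "inj_on e (carrier T)"
    and g: "g \<in> ring_hom S T" and h: "h \<in> ring_hom S T"
    and eq: "\<And>x. x \<in> carrier R \<Longrightarrow> g (\<psi> x) = h (\<psi> x)" and s: "s \<in> carrier S"
  shows "g s = h s"
proof -
  have eh: "e \<in> ring_hom T (image_ring e T)"
    using inj_imp_image_ring_iso[OF e] by (simp add: ring_iso_def)
  have *: "\<And>(T' :: 'u ring) g h. \<lbrakk>ring T'; g \<in> ring_hom S T'; h \<in> ring_hom S T';
      \<forall>x\<in>carrier R. g (\<psi> x) = h (\<psi> x)\<rbrakk> \<Longrightarrow> \<forall>s\<in>carrier S. g s = h s"
    using epi unfolding ring_epimorphism_def by blast
  have "\<forall>s\<in>carrier S. (e \<circ> g) s = (e \<circ> h) s"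
    by (rule *[OF ring.inj_imp_image_ring_is_ring[OF T e] ring_hom_trans[OF g eh]
          ring_hom_trans[OF h eh]]) (simp add: eq)
  then have "e (g s) = e (h s)"
    using s by simp
  then show ?thesis
    using inj_onD[OF e _ ring_hom_memE(1)[OF g s] ring_hom_memE(1)[OF h s]] by simp
qed

text \<open>The inclusion into the trivial extension and its twist by the derivation agree on the
  image of \<open>R\<close>, hence on \<open>S\<close>; comparing second components gives
  \<open>s \<otimes> 1 = 1 \<otimes> s\<close>.\<close>

lemma (in change_of_rings) derivation_in_rels:
  assumes inf: "infinite (UNIV :: 's set)" and epi: "ring_epimorphism TYPE('s) R S \<psi>"
    and s: "s \<in> carrier S"
  shows "derivation s \<in> SS.rels"
proof -
  obtain e :: "'s \<times> ('s \<times> 's \<Rightarrow>\<^sub>0 int) \<Rightarrow> 's" where "inj e"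
    using lepoll_frag_times[OF inf] unfolding lepoll_def by blast
  then have e: "inj_on e (carrier trivial_extension)"
    using inj_on_subset by blast
  have "(s, SS.cls 0) = (s, SS.cls (derivation s))"
  proof (rule ring_epimorphism_cancel[OF epi ring_trivial_extension e trivial_extension_incl
        trivial_extension_twist _ s])
    fix x assume x: "x \<in> carrier R"
    \<comment> \<open>This is the balancing relation that moves \<open>\<psi> x\<close> across the
      tensor sign between two units.\<close>
    have "derivation (\<psi> x) \<in> SS.rels"
      using SS.rels_balanced[of x "\<one>\<^bsub>S\<^esub>" "\<one>\<^bsub>S\<^esub>"] x by (simp add: hom_closed)
    from SS.rels_minus[OF this] show "(\<psi> x, SS.cls 0) = (\<psi> x, SS.cls (derivation (\<psi> x)))"
      by (simp add: SS.cls_eq_iff)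
  qed
  then show ?thesis
    using SS.rels_minus by (fastforce simp: SS.cls_eq_iff)
qed

section \<open>Modules over a flat epimorphic extension\<close>

lemma (in abelian_group) eq_of_minus_eq_zero:
  assumes "x \<in> carrier G" "y \<in> carrier G" "x \<ominus> y = \<zero>"
  shows "x = y"
  using assms by (metis a_minus_def a_inv_closed minus_equality minus_minus)

lemma (in left_module) smult_diff:
  assumes "a \<in> carrier R" "x \<in> carrier M" "y \<in> carrier M"
  shows "a \<odot>\<^bsub>M\<^esub> (x \<ominus>\<^bsub>M\<^esub> y) = a \<odot>\<^bsub>M\<^esub> x \<ominus>\<^bsub>M\<^esub> a \<odot>\<^bsub>M\<^esub> y"
proof -
  have "a \<odot>\<^bsub>M\<^esub> (x \<ominus>\<^bsub>M\<^esub> y) \<oplus>\<^bsub>M\<^esub> a \<odot>\<^bsub>M\<^esub> y = a \<odot>\<^bsub>M\<^esub> x"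
    using assms smult_r_distr[of a "x \<ominus>\<^bsub>M\<^esub> y" y]
    by (simp add: M.minus_eq M.a_assoc M.l_neg)
  moreover have "a \<odot>\<^bsub>M\<^esub> (x \<ominus>\<^bsub>M\<^esub> y) \<in> carrier M" "a \<odot>\<^bsub>M\<^esub> y \<in> carrier M"
    using assms smult_closed M.minus_closed by blast+
  ultimately show ?thesis
    by (metis M.a_assoc M.a_inv_closed M.minus_eq M.r_neg M.r_zero)
qed

lemma (in left_module) smult_zero: "a \<in> carrier R \<Longrightarrow> a \<odot>\<^bsub>M\<^esub> \<zero>\<^bsub>M\<^esub> = \<zero>\<^bsub>M\<^esub>"
  using smult_diff[of a "\<zero>\<^bsub>M\<^esub>" "\<zero>\<^bsub>M\<^esub>"] smult_closed[of a "\<zero>\<^bsub>M\<^esub>"]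
  by (simp add: M.minus_eq M.r_neg)

section \<open>Submodules, and flatness in terms of relations\<close>

lemma (in left_module) left_module_submodule:
  assumes "submodule N R M"
  shows "left_module R (M\<lparr>carrier := N\<rparr>)"
proof -
  interpret N: submodule N R M by (rule assms)
  have sub: "x \<in> carrier M" if "x \<in> N" for x
    using N.subset that by auto
  have neg: "\<ominus>\<^bsub>M\<^esub> x \<in> N" if "x \<in> N" for x
    using N.m_inv_closed[OF that] by (simp add: a_inv_def)
  have "abelian_group (M\<lparr>carrier := N\<rparr>)"
  proof (rule abelian_groupI)
    fix x assume "x \<in> carrier (M\<lparr>carrier := N\<rparr>)"
    then show "\<exists>y\<in>carrier (M\<lparr>carrier := N\<rparr>). y \<oplus>\<^bsub>M\<lparr>carrier := N\<rparr>\<^esub> x = \<zero>\<^bsub>M\<lparr>carrier := N\<rparr>\<^esub>"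
      using neg M.l_neg sub by auto
  qed (use N.m_closed N.one_closed in \<open>auto simp: sub M.a_ac\<close>)
  then show ?thesis
    unfolding left_module_def left_module_axioms_def using R.ring_axioms
    by (simp add: sub smult_l_distr smult_r_distr smult_assoc smult_one N.smult_closed)
qed

lemma lmod_homD:
  assumes "f \<in> lmod_hom R M N"
  shows "x \<in> carrier M \<Longrightarrow> f x \<in> carrier N"
    and "\<lbrakk>x \<in> carrier M; y \<in> carrier M\<rbrakk> \<Longrightarrow> f (x \<oplus>\<^bsub>M\<^esub> y) = f x \<oplus>\<^bsub>N\<^esub> f y"
    and "\<lbrakk>a \<in> carrier R; x \<in> carrier M\<rbrakk> \<Longrightarrow> f (a \<odot>\<^bsub>M\<^esub> x) = a \<odot>\<^bsub>N\<^esub> f x"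
  using assms by (auto simp: lmod_hom_def)

text \<open>The sum \<open>c\<close> represents a tensor over \<open>N\<close> that vanishes over
  \<open>M\<close>. Flatness, applied to the inclusion of \<open>N\<close>, makes it vanish over
  \<open>N\<close>. The submodule keeps the element type of \<open>M\<close>, so that flatness at
  \<open>'m\<close> covers both.\<close>

lemma (in tensor_pair) flat_rels:
  assumes flat: "flat_right_module TYPE('m) R P" and N: "submodule N R M"
    and rel: "c \<in> rels" and supp: "Poly_Mapping.keys c \<subseteq> carrier P \<times> N"
  shows "c \<in> tensor_relations R P (M\<lparr>carrier := N\<rparr>)"
proof -
  let ?N = "M\<lparr>carrier := N\<rparr>"
  interpret N: submodule N R M by (rule N)
  interpret TN: tensor_pair R P ?N
    by (intro tensor_pair.intro P.right_module_axioms M.left_module_submodule N)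
  have NM: "x \<in> carrier M" if "x \<in> N" for x
    using N.subset that by auto
  have id: "frag_extend frag_of d = d" for d :: "('p \<times> 'm) \<Rightarrow>\<^sub>0 int"
    using frag_expansion[of d] by simp
  have sub: "d \<in> rels" if "d \<in> TN.rels" for d
  proof -
    have "frag_extend (frag_of \<circ> (\<lambda>z. z)) d \<in> rels"
      by (rule TN.rels_image[OF tensor_pair_axioms _ _ _ _ that])
        (auto simp: NM rels_distrib_left rels_distrib_right rels_balanced)
    then show ?thesis
      by (simp add: o_def id)
  qed
  \<comment> \<open>A coset inside \<open>rels\<close> is sent to the zero coset, which is
    \<open>rels\<close> itself; nonemptiness matters since \<open>tensor_map\<close> is a union over
    the coset. It applies to the cosets of \<open>c\<close> and of \<open>0\<close>, which
    injectivity then identifies.\<close>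
  have map: "tensor_map R P M (\<lambda>x. x) C = rels" if "C \<subseteq> rels" "C \<noteq> {}" for C
  proof -
    have "rels #>\<^bsub>free_Abelian_group (carrier P \<times> carrier M)\<^esub> d = rels" if "d \<in> rels" for d
      using group.coset_join2[OF group_free_Abelian_group _ rels_subgroup that] that rels_subset
      by auto
    moreover have "(\<lambda>(p, x). frag_of (p, x)) = (frag_of :: 'p \<times> 'm \<Rightarrow> _)"
      by auto
    ultimately show ?thesis
      using that unfolding tensor_map_def by (auto simp: id)
  qed
  have coset: "TN.rels #>\<^bsub>free_Abelian_group (carrier P \<times> N)\<^esub> d = (\<lambda>h. h + d) ` TN.rels" for d
    by (auto simp: r_coset_def)
  have tens: "(\<lambda>h. h + d) ` TN.rels \<in> carrier (tensor R P ?N)"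
    if "Poly_Mapping.keys d \<subseteq> carrier P \<times> N" for d
    using that by (auto simp: tensor_def FactGroup_def RCOSETS_def coset)
  have "inj_on (tensor_map R P M (\<lambda>x. x)) (carrier (tensor R P ?N))"
    using flat TN.M.left_module_axioms M.left_module_axioms NM
    unfolding flat_right_module_def by (auto simp: lmod_hom_def)
  moreover have "tensor_map R P M (\<lambda>x. x) ((\<lambda>h. h + c) ` TN.rels) = rels"
    using TN.rels_zero sub rels_add rel by (intro map) auto
  moreover have "tensor_map R P M (\<lambda>x. x) ((\<lambda>h. h + 0) ` TN.rels) = rels"
    using TN.rels_zero sub by (intro map) auto
  ultimately have "(\<lambda>h. h + c) ` TN.rels = (\<lambda>h. h + 0) ` TN.rels"
    using tens[OF supp] tens[of 0] by (auto dest: inj_onD)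
  moreover have "c \<in> (\<lambda>h. h + c) ` TN.rels"
    using TN.rels_zero by force
  ultimately show ?thesis
    by simp
qed

text \<open>The assumption is the elementwise form of being an epimorphism. It mentions no universe,
  so the modules below may have elements of any type.\<close>

locale epimorphic_change_of_rings = change_of_rings R S \<psi>
  for R :: "('a, 'r) ring_scheme" and S :: "('s, 'z) ring_scheme" and \<psi> :: "'a \<Rightarrow> 's" +
  assumes derivation_in_rels: "s \<in> carrier S \<Longrightarrow> derivation s \<in> SS.rels"
begin

section \<open>Comparison of \<open>S\<close>-modules with their restrictions to
  \<open>R\<close>\<close>

lemma tensor_pair_restrict:
  "left_module S M \<Longrightarrow> tensor_pair R (right_via S \<psi>) (restrict_scalars \<psi> M)"
  by (intro tensor_pair.intro right_module_right_via left_module_restrict_scalars)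

text \<open>The map \<open>p \<otimes> q \<mapsto> p \<otimes> q x\<close> from the tensor square
  carries \<open>s \<otimes> 1 - 1 \<otimes> s\<close> to the difference in question.\<close>

lemma swap_in_rels:
  assumes M: "left_module S M" and s: "s \<in> carrier S" and x: "x \<in> carrier M"
  shows "frag_of (s, x) - frag_of (\<one>\<^bsub>S\<^esub>, s \<odot>\<^bsub>M\<^esub> x)
    \<in> tensor_relations R (right_via S \<psi>) (restrict_scalars \<psi> M)"
proof -
  interpret M: left_module S M by (rule M)
  interpret T: tensor_pair R "right_via S \<psi>" "restrict_scalars \<psi> M"
    by (rule tensor_pair_restrict[OF M])
  let ?k = "\<lambda>(p, q). (p, q \<odot>\<^bsub>M\<^esub> x)"
  have "frag_extend (frag_of \<circ> ?k) (derivation s) \<in> T.rels"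
  proof (rule SS.rels_image[OF T.tensor_pair_axioms _ _ _ _ derivation_in_rels[OF s]])
    show "frag_of (?k (p \<oplus>\<^bsub>right_via S \<psi>\<^esub> q, y)) - frag_of (?k (p, y)) - frag_of (?k (q, y)) \<in> T.rels"
      if "p \<in> carrier (right_via S \<psi>)" "q \<in> carrier (right_via S \<psi>)" "y \<in> carrier (left_via S \<psi>)"
      for p q y
      using that x T.rels_distrib_left[of p q "y \<odot>\<^bsub>M\<^esub> x"] by (simp add: M.smult_closed)
    show "frag_of (?k (p, y \<oplus>\<^bsub>left_via S \<psi>\<^esub> z)) - frag_of (?k (p, y)) - frag_of (?k (p, z)) \<in> T.rels"
      if "p \<in> carrier (right_via S \<psi>)" "y \<in> carrier (left_via S \<psi>)" "z \<in> carrier (left_via S \<psi>)"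
      for p y z
      using that x T.rels_distrib_right[of p "y \<odot>\<^bsub>M\<^esub> x" "z \<odot>\<^bsub>M\<^esub> x"]
      by (simp add: M.smult_closed M.smult_l_distr)
    show "frag_of (?k (a \<odot>\<^bsub>right_via S \<psi>\<^esub> p, y)) - frag_of (?k (p, a \<odot>\<^bsub>left_via S \<psi>\<^esub> y)) \<in> T.rels"
      if "a \<in> carrier R" "p \<in> carrier (right_via S \<psi>)" "y \<in> carrier (left_via S \<psi>)" for a p y
      using that x T.rels_balanced[of a p "y \<odot>\<^bsub>M\<^esub> x"]
      by (simp add: M.smult_closed M.smult_assoc hom_closed)
  qed (use x in \<open>auto simp: M.smult_closed\<close>)
  then show ?thesis
    using x by (simp add: frag_extend_diff M.smult_one)
qed

text \<open>For \<open>R\<close>-linear \<open>g\<close>, the assignment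
  \<open>s \<otimes> x \<mapsto> s g(x)\<close> is balanced, so it takes the same value on
  \<open>s \<otimes> x\<close> and on \<open>1 \<otimes> s x\<close>. These values are
  \<open>s g(x)\<close> and \<open>g(s x)\<close>.\<close>

lemma lmod_hom_restrict_iff:
  assumes B: "left_module S B" and M: "left_module S M"
  shows "g \<in> lmod_hom R (restrict_scalars \<psi> B) (restrict_scalars \<psi> M) \<longleftrightarrow> g \<in> lmod_hom S B M"
proof
  assume "g \<in> lmod_hom S B M"
  then show "g \<in> lmod_hom R (restrict_scalars \<psi> B) (restrict_scalars \<psi> M)"
    by (auto simp: lmod_hom_def hom_closed)
next
  assume g: "g \<in> lmod_hom R (restrict_scalars \<psi> B) (restrict_scalars \<psi> M)"
  note g' = lmod_homD[OF g, simplified]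
  interpret B: left_module S B by (rule B)
  interpret M: left_module S M by (rule M)
  interpret T: tensor_pair R "right_via S \<psi>" "restrict_scalars \<psi> B"
    by (rule tensor_pair_restrict[OF B])
  obtain h where diff: "\<And>c d. \<lbrakk>c \<in> T.frags; d \<in> T.frags\<rbrakk> \<Longrightarrow> h (c - d) = h c \<ominus>\<^bsub>M\<^esub> h d"
    and of: "\<And>p x. \<lbrakk>p \<in> carrier (right_via S \<psi>); x \<in> carrier (restrict_scalars \<psi> B)\<rbrakk>
      \<Longrightarrow> h (frag_of (p, x)) = p \<odot>\<^bsub>M\<^esub> g x"
    and rel: "\<And>c. c \<in> T.rels \<Longrightarrow> h c = \<zero>\<^bsub>M\<^esub>"
    by (rule T.balanced_extension[where \<beta> = "\<lambda>s x. s \<odot>\<^bsub>M\<^esub> g x", OF M.abelian_group_axioms])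
      (auto simp: g' hom_closed M.smult_closed M.smult_l_distr M.smult_r_distr M.smult_assoc)
  have "g (s \<odot>\<^bsub>B\<^esub> x) = s \<odot>\<^bsub>M\<^esub> g x" if s: "s \<in> carrier S" and x: "x \<in> carrier B" for s x
  proof -
    have sx: "s \<odot>\<^bsub>B\<^esub> x \<in> carrier B"
      using s x by (rule B.smult_closed)
    have "s \<odot>\<^bsub>M\<^esub> g x \<ominus>\<^bsub>M\<^esub> g (s \<odot>\<^bsub>B\<^esub> x) = \<zero>\<^bsub>M\<^esub>"
      using rel[OF swap_in_rels[OF B s x]] s x sx by (simp add: diff of g' M.smult_one)
    then show ?thesis
      using M.eq_of_minus_eq_zero[OF M.smult_closed[OF s g'(1)[OF x]] g'(1)[OF sx]] by simp
  qed
  then show "g \<in> lmod_hom S B M"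
    using g' by (auto simp: lmod_hom_def)
qed

text \<open>Both sides are additive in \<open>c\<close>, so generators decide. With general
  \<open>X\<close> and \<open>\<phi>\<close> it yields \<open>S\<close>-linearity of the
  multiplication on sums over \<open>N\<close> (\<open>\<phi>\<close> the identity) and of the map
  induced by \<open>f\<close>.\<close>

lemma extension_smult:
  assumes M: "left_module S M" and \<phi>: "\<And>x. x \<in> X \<Longrightarrow> \<phi> x \<in> carrier M"
    and cl: "\<And>c. c \<in> carrier (free_Abelian_group (carrier S \<times> X)) \<Longrightarrow> h c \<in> carrier M"
    and h_diff: "\<And>c d. \<lbrakk>c \<in> carrier (free_Abelian_group (carrier S \<times> X));
        d \<in> carrier (free_Abelian_group (carrier S \<times> X))\<rbrakk> \<Longrightarrow> h (c - d) = h c \<ominus>\<^bsub>M\<^esub> h d"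
    and of: "\<And>p x. \<lbrakk>p \<in> carrier S; x \<in> X\<rbrakk> \<Longrightarrow> h (frag_of (p, x)) = p \<odot>\<^bsub>M\<^esub> \<phi> x"
    and s: "s \<in> carrier S" and c: "c \<in> carrier (free_Abelian_group (carrier S \<times> X))"
  defines "l \<equiv> frag_extend (frag_of \<circ> (\<lambda>(p, x). (s \<otimes>\<^bsub>S\<^esub> p, x)))"
  shows "l c \<in> carrier (free_Abelian_group (carrier S \<times> X))" and "h (l c) = s \<odot>\<^bsub>M\<^esub> h c"
proof -
  interpret M: left_module S M by (rule M)
  have l: "l d \<in> carrier (free_Abelian_group (carrier S \<times> X))"
    if "d \<in> carrier (free_Abelian_group (carrier S \<times> X))" for d
    using that unfolding carrier_free_Abelian_group_iff l_def
    by (rule keys_frag_extend_of) (use s in auto)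
  then show "l c \<in> carrier (free_Abelian_group (carrier S \<times> X))"
    using c .
  have h_zero: "h 0 = \<zero>\<^bsub>M\<^esub>"
    using h_diff[of 0 0] cl[of 0] by (simp add: M.minus_eq M.r_neg)
  have "Poly_Mapping.keys c \<subseteq> carrier S \<times> X"
    using c by simp
  then show "h (l c) = s \<odot>\<^bsub>M\<^esub> h c"
  proof (induction c rule: free_Abelian_group_induct[consumes 1, case_names zero diff one])
    case zero
    then show ?case
      using s by (simp add: l_def h_zero M.smult_zero)
  next
    case (diff x y)
    then have xy: "x \<in> carrier (free_Abelian_group (carrier S \<times> X))"
      "y \<in> carrier (free_Abelian_group (carrier S \<times> X))"
      by simp_all
    have "h (l (x - y)) = h (l x) \<ominus>\<^bsub>M\<^esub> h (l y)"
      using h_diff[OF l l, OF xy] by (simp add: l_def frag_extend_diff)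
    then show ?case
      using diff.IH s h_diff[OF xy] cl[OF xy(1)] cl[OF xy(2)] by (simp add: M.smult_diff)
  next
    case (one z)
    then show ?case
      using s by (auto simp: l_def of \<phi> M.smult_assoc)
  qed
qed

text \<open>Every generator \<open>s \<otimes> x\<close> is congruent to
  \<open>1 \<otimes> s x\<close>, and additivity in the second factor collects such terms. Hence the
  multiplication \<open>\<mu>\<close> is injective on the tensor product.\<close>

lemma tensor_normal_form:
  assumes M: "left_module S M"
    and \<mu>_cl: "\<And>c. c \<in> carrier (free_Abelian_group (carrier S \<times> carrier M)) \<Longrightarrow> \<mu> c \<in> carrier M"
    and \<mu>_diff: "\<And>c d. \<lbrakk>c \<in> carrier (free_Abelian_group (carrier S \<times> carrier M));
        d \<in> carrier (free_Abelian_group (carrier S \<times> carrier M))\<rbrakk> \<Longrightarrow> \<mu> (c - d) = \<mu> c \<ominus>\<^bsub>M\<^esub> \<mu> d"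
    and \<mu>_of: "\<And>p x. \<lbrakk>p \<in> carrier S; x \<in> carrier M\<rbrakk> \<Longrightarrow> \<mu> (frag_of (p, x)) = p \<odot>\<^bsub>M\<^esub> x"
    and c: "Poly_Mapping.keys c \<subseteq> carrier S \<times> carrier M"
  shows "c - frag_of (\<one>\<^bsub>S\<^esub>, \<mu> c) \<in> tensor_relations R (right_via S \<psi>) (restrict_scalars \<psi> M)"
proof -
  interpret M: left_module S M by (rule M)
  interpret T: tensor_pair R "right_via S \<psi>" "restrict_scalars \<psi> M"
    by (rule tensor_pair_restrict[OF M])
  have "\<mu> 0 = \<zero>\<^bsub>M\<^esub>"
    using \<mu>_diff[of 0 0] \<mu>_cl[of 0] by (simp add: M.minus_eq M.r_neg)
  \<comment> \<open>The generator at \<open>(1, 0)\<close> is not the zero formal sum; it is a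
    relation because \<open>0 + 0 = 0\<close> in \<open>M\<close>.\<close>
  then have base: "0 - frag_of (\<one>\<^bsub>S\<^esub>, \<mu> 0) \<in> T.rels"
    using T.rels_distrib_right[of "\<one>\<^bsub>S\<^esub>" "\<zero>\<^bsub>M\<^esub>" "\<zero>\<^bsub>M\<^esub>"] by simp
  show ?thesis
    using c
  proof (induction c rule: free_Abelian_group_induct[consumes 1, case_names zero diff one])
    case zero
    show ?case by (rule base)
  next
    case (diff x y)
    then have xy: "x \<in> carrier (free_Abelian_group (carrier S \<times> carrier M))"
      "y \<in> carrier (free_Abelian_group (carrier S \<times> carrier M))"
      by simp_all
    let ?d = "\<mu> x \<ominus>\<^bsub>M\<^esub> \<mu> y"
    have cl: "\<mu> x \<in> carrier M" "\<mu> y \<in> carrier M"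
      using xy \<mu>_cl by blast+
    \<comment> \<open>The distributivity relation is stated for sums, so the difference is rewritten
      as one.\<close>
    have "?d \<oplus>\<^bsub>M\<^esub> \<mu> y = \<mu> x"
      using cl by (simp add: M.minus_eq M.a_assoc M.l_neg)
    then have "frag_of (\<one>\<^bsub>S\<^esub>, \<mu> x) - frag_of (\<one>\<^bsub>S\<^esub>, ?d) - frag_of (\<one>\<^bsub>S\<^esub>, \<mu> y) \<in> T.rels"
      using T.rels_distrib_right[of "\<one>\<^bsub>S\<^esub>" ?d "\<mu> y"] cl by simp
    from T.rels_add[OF this T.rels_diff[OF diff.IH]] show ?case
      using \<mu>_diff[OF xy] by (simp add: algebra_simps)
  next
    case (one z)
    then show ?case
      using swap_in_rels[OF M] by (auto simp: \<mu>_of)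
  qed
qed

lemma quasi_injective_restrict_scalars:
  fixes M :: "('s, 'm) module"
  assumes flat: "flat_right_module TYPE('m) R (right_via S \<psi>)" and QI: "quasi_injective S M"
  shows "quasi_injective R (restrict_scalars \<psi> M)"
proof -
  let ?M = "restrict_scalars \<psi> M" and ?P = "right_via S \<psi>"
  have M: "left_module S M"
    using QI by (simp add: quasi_injective_def)
  interpret M: left_module S M by (rule M)
  interpret T: tensor_pair R ?P ?M
    by (rule tensor_pair_restrict[OF M])
  obtain \<mu> where \<mu>_cl: "\<And>c. c \<in> T.frags \<Longrightarrow> \<mu> c \<in> carrier M"
    and \<mu>_add: "\<And>c d. \<lbrakk>c \<in> T.frags; d \<in> T.frags\<rbrakk> \<Longrightarrow> \<mu> (c + d) = \<mu> c \<oplus>\<^bsub>M\<^esub> \<mu> d"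
    and \<mu>_diff: "\<And>c d. \<lbrakk>c \<in> T.frags; d \<in> T.frags\<rbrakk> \<Longrightarrow> \<mu> (c - d) = \<mu> c \<ominus>\<^bsub>M\<^esub> \<mu> d"
    and \<mu>_of: "\<And>p x. \<lbrakk>p \<in> carrier ?P; x \<in> carrier ?M\<rbrakk> \<Longrightarrow> \<mu> (frag_of (p, x)) = p \<odot>\<^bsub>M\<^esub> x"
    by (rule T.balanced_extension[where \<beta> = "\<lambda>s x. s \<odot>\<^bsub>M\<^esub> x", OF M.abelian_group_axioms])
      (auto simp: hom_closed M.smult_closed M.smult_l_distr M.smult_r_distr M.smult_assoc)
  have extends: "\<exists>g\<in>lmod_hom R ?M ?M. \<forall>x\<in>N. g x = f x"
    if N: "submodule N R ?M" and f: "f \<in> lmod_hom R (?M\<lparr>carrier := N\<rparr>) ?M" for N f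
  proof -
    interpret N: submodule N R ?M by (rule N)
    interpret TN: tensor_pair R ?P "?M\<lparr>carrier := N\<rparr>"
      by (intro tensor_pair.intro right_module_right_via T.M.left_module_submodule N)
    note f' = lmod_homD[OF f, simplified]
    have NM: "x \<in> carrier M" if "x \<in> N" for x
      using N.subset that by auto
    have frags: "c \<in> T.frags" if "c \<in> TN.frags" for c
      using that NM by (auto simp: subset_iff)
    obtain \<nu> where \<nu>_cl: "\<And>c. c \<in> TN.frags \<Longrightarrow> \<nu> c \<in> carrier M"
      and \<nu>_add: "\<And>c d. \<lbrakk>c \<in> TN.frags; d \<in> TN.frags\<rbrakk> \<Longrightarrow> \<nu> (c + d) = \<nu> c \<oplus>\<^bsub>M\<^esub> \<nu> d"
      and \<nu>_diff: "\<And>c d. \<lbrakk>c \<in> TN.frags; d \<in> TN.frags\<rbrakk> \<Longrightarrow> \<nu> (c - d) = \<nu> c \<ominus>\<^bsub>M\<^esub> \<nu> d"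
      and \<nu>_of: "\<And>p x. \<lbrakk>p \<in> carrier ?P; x \<in> carrier (?M\<lparr>carrier := N\<rparr>)\<rbrakk>
        \<Longrightarrow> \<nu> (frag_of (p, x)) = p \<odot>\<^bsub>M\<^esub> f x"
      and \<nu>_rels: "\<And>c. c \<in> TN.rels \<Longrightarrow> \<nu> c = \<zero>\<^bsub>M\<^esub>"
      by (rule TN.balanced_extension[where \<beta> = "\<lambda>s x. s \<odot>\<^bsub>M\<^esub> f x", OF M.abelian_group_axioms])
        (auto simp: f' hom_closed M.smult_closed M.smult_l_distr M.smult_r_distr M.smult_assoc)
    \<comment> \<open>Here \<open>\<mu>\<close> multiplies out a formal sum and \<open>\<nu>\<close>
      does so after applying \<open>f\<close>. That \<open>\<nu>\<close> depends only on the value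
      of \<open>\<mu>\<close> is what makes the extension of \<open>f\<close> to \<open>S N\<close>
      well defined.\<close>
    have \<nu>_eq: "\<nu> c = \<nu> d" if cd: "c \<in> TN.frags" "d \<in> TN.frags" and "\<mu> c = \<mu> d" for c d
    proof -
      have "\<mu> (c - d) = \<zero>\<^bsub>M\<^esub>"
        using \<mu>_diff[of c d] \<mu>_cl[of d] frags[OF cd(1)] frags[OF cd(2)] that(3)
        by (simp add: M.minus_eq M.r_neg)
      moreover have "c - d \<in> TN.frags"
        by (rule diff_in_free_Abelian_group[OF cd])
      \<comment> \<open>By the normal form, \<open>c - d\<close> is congruent to
        \<open>1 \<otimes> 0\<close>, which is itself a relation. Flatness then turns a relation
        over \<open>M\<close> into one over \<open>N\<close>.\<close>
      ultimately have "c - d - frag_of (\<one>\<^bsub>S\<^esub>, \<zero>\<^bsub>M\<^esub>) \<in> T.rels"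
        using tensor_normal_form[OF M, of \<mu> "c - d"] \<mu>_cl \<mu>_diff \<mu>_of frags[of "c - d"] by simp
      moreover have "frag_of (\<one>\<^bsub>S\<^esub>, \<zero>\<^bsub>M\<^esub>) \<in> T.rels"
        using T.rels_minus[OF T.rels_distrib_right[of "\<one>\<^bsub>S\<^esub>" "\<zero>\<^bsub>M\<^esub>" "\<zero>\<^bsub>M\<^esub>"]] by simp
      ultimately have "c - d \<in> T.rels"
        using T.rels_add by fastforce
      then have "c - d \<in> TN.rels"
        using T.flat_rels[OF flat N] diff_in_free_Abelian_group[OF cd] by simp
      then have "\<nu> c \<ominus>\<^bsub>M\<^esub> \<nu> d = \<zero>\<^bsub>M\<^esub>"
        using \<nu>_rels \<nu>_diff cd by metis
      then show ?thesis
        by (rule M.eq_of_minus_eq_zero[OF \<nu>_cl \<nu>_cl, OF cd])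
    qed
    \<comment> \<open>This is the \<open>S\<close>-submodule generated by \<open>N\<close>;
      \<open>f'\<close> evaluates \<open>\<nu>\<close> at any formal sum that represents the given
      element.\<close>
    let ?SN = "\<mu> ` TN.frags"
    define f' where "f' y = \<nu> (SOME c. c \<in> TN.frags \<and> \<mu> c = y)" for y
    have f'_\<mu>: "f' (\<mu> c) = \<nu> c" if "c \<in> TN.frags" for c
    proof -
      have "\<exists>d. d \<in> TN.frags \<and> \<mu> d = \<mu> c"
        using that by blast
      from someI_ex[OF this] show ?thesis
        unfolding f'_def using \<nu>_eq that by blast
    qed
    have add_frags: "c + d \<in> TN.frags" if "c \<in> TN.frags" "d \<in> TN.frags" for c d
      using that by (simp add: keys_add_subset)
    have lact_N: "lact s c \<in> TN.frags" and \<mu>_smult: "\<mu> (lact s c) = s \<odot>\<^bsub>M\<^esub> \<mu> c"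
      if "s \<in> carrier S" "c \<in> TN.frags" for s c
      using extension_smult[OF M, of N "\<lambda>x. x" \<mu> s c] that frags \<mu>_cl \<mu>_diff \<mu>_of NM by simp_all
    have \<nu>_smult: "\<nu> (lact s c) = s \<odot>\<^bsub>M\<^esub> \<nu> c" if "s \<in> carrier S" "c \<in> TN.frags" for s c
      using extension_smult(2)[OF M, of N f \<nu> s c] that \<nu>_cl \<nu>_diff \<nu>_of f'(1) by simp
    have SN: "submodule ?SN S M"
    proof (intro submodule.intro subgroup.intro submodule_axioms.intro)
      show "?SN \<subseteq> carrier (add_monoid M)"
        using \<mu>_cl frags by auto
      have 0: "0 \<in> TN.frags"
        by simp
      then have "\<mu> 0 = \<zero>\<^bsub>M\<^esub>"
        using \<mu>_diff[of 0 0] \<mu>_cl[of 0] by (simp add: M.minus_eq M.r_neg)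
      with 0 show "\<one>\<^bsub>add_monoid M\<^esub> \<in> ?SN"
        by (metis imageI monoid.select_convs(2))
      fix x assume "x \<in> ?SN"
      then obtain c where c: "c \<in> TN.frags" "x = \<mu> c" by blast
      have "\<mu> (0 - c) = \<ominus>\<^bsub>M\<^esub> x"
        using \<mu>_diff[of 0 c] \<mu>_cl[of c] c frags \<open>\<mu> 0 = \<zero>\<^bsub>M\<^esub>\<close> by (simp add: M.minus_eq)
      then show "inv\<^bsub>add_monoid M\<^esub> x \<in> ?SN"
        using diff_in_free_Abelian_group[OF 0 c(1)] imageI[of "0 - c" TN.frags \<mu>] by (simp only: a_inv_def)
      show "s \<odot>\<^bsub>M\<^esub> x \<in> ?SN" if "s \<in> carrier S" for s
        using imageI[OF lact_N[OF that c(1)], of \<mu>] unfolding \<mu>_smult[OF that c(1)] c(2) .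
      fix y assume "y \<in> ?SN"
      then obtain d where d: "d \<in> TN.frags" "y = \<mu> d" by blast
      have "x \<oplus>\<^bsub>M\<^esub> y = \<mu> (c + d)"
        unfolding c(2) d(2) by (rule \<mu>_add[OF frags frags, OF c(1) d(1), symmetric])
      then show "x \<otimes>\<^bsub>add_monoid M\<^esub> y \<in> ?SN"
        using imageI[OF add_frags[OF c(1) d(1)], of \<mu>] by simp
    qed
    have "f' \<in> lmod_hom S (M\<lparr>carrier := ?SN\<rparr>) M"
    proof -
      have "f' (\<mu> c \<oplus>\<^bsub>M\<^esub> \<mu> d) = f' (\<mu> c) \<oplus>\<^bsub>M\<^esub> f' (\<mu> d)"
        if "c \<in> TN.frags" "d \<in> TN.frags" for c d
        using \<mu>_add[OF frags frags, OF that] \<nu>_add[OF that] f'_\<mu>[OF add_frags[OF that]]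
          f'_\<mu>[OF that(1)] f'_\<mu>[OF that(2)] by simp
      moreover have "f' (s \<odot>\<^bsub>M\<^esub> \<mu> c) = s \<odot>\<^bsub>M\<^esub> f' (\<mu> c)"
        if "s \<in> carrier S" "c \<in> TN.frags" for s c
        using \<mu>_smult[OF that] \<nu>_smult[OF that] f'_\<mu>[OF lact_N[OF that]] f'_\<mu>[OF that(2)]
        by simp
      ultimately show ?thesis
        using f'_\<mu> \<nu>_cl by (auto simp: lmod_hom_def simp del: carrier_free_Abelian_group_iff)
    qed
    then obtain g where g: "g \<in> lmod_hom S M M" and ext: "\<forall>x\<in>?SN. g x = f' x"
      using QI SN unfolding quasi_injective_def by blast
    have "g x = f x" if x: "x \<in> N" for x
    proof -
      \<comment> \<open>An element of \<open>N\<close> lies in \<open>S N\<close> as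
        \<open>1 x\<close>, where \<open>f'\<close> takes the value \<open>1 f(x)\<close>.\<close>
      let ?c = "frag_of (\<one>\<^bsub>S\<^esub>, x)"
      have c: "?c \<in> TN.frags" "\<mu> ?c = x" "\<nu> ?c = f x"
        using x NM[OF x] f'(1)[OF x] by (simp_all add: \<mu>_of \<nu>_of M.smult_one)
      then show ?thesis
        using bspec[OF ext imageI[OF c(1)]] f'_\<mu>[OF c(1)] by simp
    qed
    then show ?thesis
      using g lmod_hom_restrict_iff[OF M M] by blast
  qed
  then show ?thesis
    using left_module_restrict_scalars[OF M] by (simp add: quasi_injective_def)
qed

text \<open>A diagram over \<open>S\<close> is also one over \<open>R\<close>, with the same element
  types; the \<open>R\<close>-linear map completing it is automatically
  \<open>S\<close>-linear.\<close>

lemma injective_of_restrict_scalars: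
  fixes M :: "('s, 'm) module"
  assumes M: "left_module S M" and inj: "injective_lmod R (restrict_scalars \<psi> M)"
  shows "injective_lmod S M"
  unfolding injective_lmod_def
proof (intro conjI allI impI M)
  fix A B :: "('s, 'm) module" and i f
  assume *: "left_module S A \<and> left_module S B \<and> i \<in> lmod_hom S A B \<and> inj_on i (carrier A)
    \<and> f \<in> lmod_hom S A M"
  then have "i \<in> lmod_hom R (restrict_scalars \<psi> A) (restrict_scalars \<psi> B)"
    "f \<in> lmod_hom R (restrict_scalars \<psi> A) (restrict_scalars \<psi> M)"
    using M by (simp_all add: lmod_hom_restrict_iff)
  moreover have "left_module R (restrict_scalars \<psi> A)" "left_module R (restrict_scalars \<psi> B)"
    using * left_module_restrict_scalars by blast+
  moreover have "inj_on i (carrier (restrict_scalars \<psi> A))"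
    using * by simp
  ultimately have "\<exists>g\<in>lmod_hom R (restrict_scalars \<psi> B) (restrict_scalars \<psi> M).
      \<forall>x\<in>carrier (restrict_scalars \<psi> A). g (i x) = f x"
    using inj unfolding injective_lmod_def by blast
  then show "\<exists>g\<in>lmod_hom S B M. \<forall>x\<in>carrier A. g (i x) = f x"
    using * M lmod_hom_restrict_iff[of B M] by auto
qed

end

theorem proposition3p10:
  fixes R :: "('a, 'r) ring_scheme"
    and \<tau> :: "('a, 'u) class_pair"
    and S :: "'u ring"
    and \<psi> :: "'a \<Rightarrow> 'u"
  assumes universe: "Pow (carrier R \<times> (UNIV :: nat set)) \<lesssim> (UNIV :: 'u set)"
    and "left_QI_ring TYPE('u) R"
    and "\<tau> \<in> R_tors R"
    and "perfect_torsion_theory R \<tau>"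
    and "ring_of_quotients R \<tau> S \<psi>"
  shows "left_QI_ring TYPE('u) S"
proof -
  have R: "ring R" and S: "ring S" and \<psi>: "\<psi> \<in> ring_hom R S"
    using assms(2,5) by (simp_all add: left_QI_ring_def ring_of_quotients_def)
  have "left_perfect_localization TYPE('u) R S \<psi>"
    using assms(4,5) unfolding perfect_torsion_theory_def by blast
  then have epi: "ring_epimorphism TYPE('u) R S \<psi>"
    and flat: "flat_right_module TYPE('u) R (right_via S \<psi>)"
    by (simp_all add: left_perfect_localization_def)
  \<comment> \<open>The carrier of \<open>R\<close> is nonempty, so its product with the naturals is
    infinite even for the zero ring. Thus the size bound makes the universe infinite, as the
    embedding of the trivial extension requires.\<close>
  have "infinite (Pow (carrier R \<times> (UNIV :: nat set)))"
    using finite_cartesian_productD2[of "carrier R" "UNIV :: nat set"] ring.ring_simprules(6)[OF R]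
    by auto
  then have "(UNIV :: nat set) \<lesssim> (UNIV :: 'u set)"
    using universe unfolding infinite_le_lepoll by (rule lepoll_trans)
  then have inf: "infinite (UNIV :: 'u set)"
    unfolding infinite_le_lepoll .
  interpret change_of_rings R S \<psi>
    using R S \<psi> by (simp add: change_of_rings_def change_of_rings_axioms_def)
  interpret epimorphic_change_of_rings R S \<psi>
    by unfold_locales (rule derivation_in_rels[OF inf epi])
  show ?thesis
    unfolding left_QI_ring_def
  proof (intro conjI allI impI S)
    fix M :: "('u, 'u) module"
    assume M: "quasi_injective S M"
    then have "injective_lmod R (restrict_scalars \<psi> M)"
      using quasi_injective_restrict_scalars[OF flat M] assms(2) by (simp add: left_QI_ring_def)
    moreover have "left_module S M"
      using M by (simp add: quasi_injective_def)
    ultimately show "injective_lmod S M"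
      by (rule injective_of_restrict_scalars[rotated])
  qed
qed

end
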